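(* Let $|v(x)|\lesssim\langle x\rangle^{-3-}$. Let $\phi\in S_1L^2(\mathbb R^4)$ and let $\psi=c_0-G_1v\phi$ with $c_0=\frac1{\|V\|_{L^1}}\int_{\mathbb R^4}v\,T\phi\,dx$, so that $\phi=Uv\psi$. Then $\phi\in S_2L^2$ if and only if $\psi\in L^p(\mathbb R^4)$ for all $4<p\le\infty$.
   Context: $V:\mathbb R^4\to\mathbb R$ is a real-valued potential, not a.e. zero, and $H=(-\Delta)^2+V$. $U(x)=1$ if $V(x)\ge0$ and $U(x)=-1$ if $V(x)<0$; $v=|V|^{1/2}$. $\langle x\rangle=(1+|x|^2)^{1/2}$, and $|v(x)|\lesssim\langle x\rangle^{-a-}$ means $|v(x)|\le C\langle x\rangle^{-a-\epsilon}$ for some $C,\epsilon>0$. $P$ is the orthogonal projection in $L^2(\mathbb R^4)$ onto the span of $v$, $Q=1-P$. $G_1f(x)=-\frac1{8\pi^2}\int_{\mathbb R^4}\log|x-y|\,f(y)\,dy$. $T=U+vG_1v$. $S_1$ is the orthogonal projection onto the kernel of $QTQ$ on $QL^2$, and $S_2$ is the orthogonal projection onto the kernel of $S_1TPTS_1$ on $S_1L^2$. *)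

theory Defs
  imports "HOL-Analysis.Analysis"
begin

text \<open>
  Elements of the complex Lebesgue spaces over \<open>real^4\<close> are represented by Lebesgue measurable
  functions. All subspaces below are closed under almost-everywhere equality, and identities
  between elements of a Lebesgue space are stated almost everywhere.
\<close>

type_synonym fn4 = "real^4 \<Rightarrow> complex"

definition Lspace :: "ennreal \<Rightarrow> fn4 set" where
  "Lspace p = {f \<in> borel_measurable lebesgue.
     if p = \<infinity> then \<exists>C. AE x in lebesgue. cmod (f x) \<le> C
     else integrable lebesgue (\<lambda>x. cmod (f x) powr enn2real p)}"

abbreviation L2 :: "fn4 set" where "L2 \<equiv> Lspace 2"

definition eq_ae :: "fn4 \<Rightarrow> fn4 \<Rightarrow> bool" where
  "eq_ae f g \<longleftrightarrow> (AE x in lebesgue. f x = g x)"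

definition L2_inner :: "fn4 \<Rightarrow> fn4 \<Rightarrow> complex" where
  "L2_inner f g = (LINT x|lebesgue. f x * cnj (g x))"

text \<open>
  For a closed subspace \<open>M\<close> the conditions determine the projection up to
  almost-everywhere equality, so the choice operator only picks a representative.
\<close>

definition orth_proj :: "fn4 set \<Rightarrow> fn4 \<Rightarrow> fn4" where
  "orth_proj M f = (SOME g. g \<in> M \<and> (\<forall>h\<in>M. L2_inner (\<lambda>x. f x - g x) h = 0))"

definition range_L2 :: "(fn4 \<Rightarrow> fn4) \<Rightarrow> fn4 set" where
  "range_L2 A = {f \<in> L2. \<exists>g\<in>L2. eq_ae f (A g)}"

definition kernel_on :: "fn4 set \<Rightarrow> (fn4 \<Rightarrow> fn4) \<Rightarrow> fn4 set" where
  "kernel_on M A = {f \<in> M. eq_ae (A f) (\<lambda>x. 0)}"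

definition japanese :: "real^4 \<Rightarrow> real" where
  "japanese x = (1 + (norm x)\<^sup>2) powr (1/2)"

definition decays_faster :: "(real^4 \<Rightarrow> real) \<Rightarrow> real \<Rightarrow> bool" where
  "decays_faster w a \<longleftrightarrow>
     (\<exists>C>0. \<exists>\<epsilon>>0. \<forall>x. \<bar>w x\<bar> \<le> C * japanese x powr (- a - \<epsilon>))"

definition sgnV :: "(real^4 \<Rightarrow> real) \<Rightarrow> real^4 \<Rightarrow> real" where
  "sgnV V x = (if V x \<ge> 0 then 1 else -1)"

definition rootV :: "(real^4 \<Rightarrow> real) \<Rightarrow> real^4 \<Rightarrow> real" where
  "rootV V x = sqrt \<bar>V x\<bar>"

definition norm_L1 :: "(real^4 \<Rightarrow> real) \<Rightarrow> real" where
  "norm_L1 w = (LINT x|lebesgue. \<bar>w x\<bar>)"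

definition G1 :: "fn4 \<Rightarrow> fn4" where
  "G1 f x = - (1 / (8 * of_real pi ^ 2)) *
     (LINT y|lebesgue. complex_of_real (ln (norm (x - y))) * f y)"

definition opT :: "(real^4 \<Rightarrow> real) \<Rightarrow> fn4 \<Rightarrow> fn4" where
  "opT V f x = of_real (sgnV V x) * f x
     + of_real (rootV V x) * G1 (\<lambda>y. of_real (rootV V y) * f y) x"

definition span_v :: "(real^4 \<Rightarrow> real) \<Rightarrow> fn4 set" where
  "span_v V = {f \<in> L2. \<exists>c::complex. eq_ae f (\<lambda>x. c * of_real (rootV V x))}"

definition opP :: "(real^4 \<Rightarrow> real) \<Rightarrow> fn4 \<Rightarrow> fn4" where
  "opP V = orth_proj (span_v V)"

definition opQ :: "(real^4 \<Rightarrow> real) \<Rightarrow> fn4 \<Rightarrow> fn4" where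
  "opQ V f x = f x - opP V f x"

definition S1 :: "(real^4 \<Rightarrow> real) \<Rightarrow> fn4 \<Rightarrow> fn4" where
  "S1 V = orth_proj (kernel_on (range_L2 (opQ V)) (opQ V \<circ> opT V \<circ> opQ V))"

definition S2 :: "(real^4 \<Rightarrow> real) \<Rightarrow> fn4 \<Rightarrow> fn4" where
  "S2 V = orth_proj (kernel_on (range_L2 (S1 V))
            (S1 V \<circ> opT V \<circ> opP V \<circ> opT V \<circ> S1 V))"

end

theory Submission
  imports Defs
begin

text \<open>
  Write \<open>v\<close> for \<open>rootV V\<close>, \<open>b(x) = 1 + |x|\<close>, and \<open>G\<close> for the operator \<open>f \<mapsto> G1 (v f)\<close>.

  The operator part rests on two identifications. The kernel of \<open>QTQ\<close> on the range of \<open>Q\<close>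
  consists of the \<open>f \<bottom> v\<close> for which \<open>T f\<close> is a multiple of \<open>v\<close>; that multiple is
  \<open>\<langle>T f, v\<rangle> / \<parallel>v\<parallel>\<^sup>2\<close>, which for \<open>f = \<phi>\<close> is the constant \<open>c\<^sub>0\<close>. The identity
  \<open>U \<phi> + v G \<phi> = c\<^sub>0 v\<close>, multiplied by \<open>U\<close>, is \<open>\<phi> = U v \<psi>\<close>. Moreover, for \<open>f\<close> in the range of
  \<open>S\<^sub>1\<close>, symmetry of \<open>T\<close> gives \<open>\<langle>S\<^sub>1 T P T S\<^sub>1 f, f\<rangle> = \<parallel>P T f\<parallel>\<^sup>2\<close>, so \<open>f\<close> lies in the range of \<open>S\<^sub>2\<close>
  exactly when \<open>T f \<bottom> v\<close> (\<open>kernel_STPTS\<close>). Hence \<open>\<phi>\<close> is in the range of \<open>S\<^sub>2\<close> iff \<open>c\<^sub>0 = 0\<close>.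
  Both kernels are orthogonal complements of explicit sets, so they are closed and the
  projections onto them exist (\<open>orth_compl_projection_exists\<close>).

  It remains to see that \<open>\<psi> = c\<^sub>0 - G \<phi>\<close> lies in every \<open>L\<^sup>p\<close> with \<open>p > 4\<close> iff \<open>c\<^sub>0 = 0\<close>. A nonzero
  constant is in no \<open>L\<^sup>p\<close> with \<open>p < \<infinity>\<close>, so it suffices that \<open>|G \<phi>| \<le> D / b\<close>, because \<open>b\<^sup>-\<^sup>p\<close> is
  integrable on \<open>\<real>\<^sup>4\<close> for \<open>p > 4\<close>. As \<open>v \<phi>\<close> has mean zero, the kernel \<open>log |x - y|\<close> may be replaced by
  \<open>log |x - y| - log b(x)\<close>, and \<open>log t \<le> t - 1\<close> applied to \<open>|x - y| / b(x)\<close> and to its inverse gives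
  two bounds without any splitting of the domain (\<open>ln_dist_diff_le\<close>, \<open>ln_dist_diff_decay\<close>):
  with \<open>\<kappa>(x,y) = 1 + 1 / |x - y|\<close>, the difference is at most \<open>b(y) \<kappa>(x,y)\<close> and also at most
  \<open>b(y)\<^sup>2 \<kappa>(x,y) / b(x)\<close>. The first bound, used with \<open>\<phi> \<in> L\<^sup>2\<close>, shows that
  \<open>G \<phi>\<close> is bounded. Then \<open>\<phi> = U v \<psi>\<close> shows \<open>|\<phi>| \<le> B v\<close>, and the second bound yields the decay.
  All the integrals that occur are controlled by one estimate, uniform in \<open>x\<close>:
  \<open>\<integral> b(y)\<^sup>-\<^sup>4\<^sup>-\<^sup>\<delta> \<kappa>(x,y)\<^sup>2 dy \<le> K\<close> (\<open>weight_inv_dist_integrable\<close>).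
\<close>

section \<open>Square integrable functions\<close>

lemma L2_iff: "f \<in> L2 \<longleftrightarrow> f \<in> borel_measurable lebesgue \<and> integrable lebesgue (\<lambda>x. (cmod (f x))\<^sup>2)"
proof -
  have "enn2real (2::ennreal) = 2" by simp
  moreover have "(2::ennreal) \<noteq> \<infinity>" by simp
  moreover have "cmod z powr 2 = (cmod z)\<^sup>2" for z
    by (simp add: powr_numeral)
  ultimately show ?thesis by (simp add: Lspace_def)
qed

lemma L2_measurable [measurable_dest]: "f \<in> L2 \<Longrightarrow> f \<in> borel_measurable lebesgue"
  and L2_integrable: "f \<in> L2 \<Longrightarrow> integrable lebesgue (\<lambda>x. (cmod (f x))\<^sup>2)"
  by (simp_all add: L2_iff)

lemma L2_bound:
  assumes "f \<in> borel_measurable lebesgue" "integrable lebesgue g" "AE x in lebesgue. (cmod (f x))\<^sup>2 \<le> g x"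
  shows "f \<in> L2"
proof -
  have "integrable lebesgue (\<lambda>x. (cmod (f x))\<^sup>2)"
    by (rule Bochner_Integration.integrable_bound[OF assms(2)]) (use assms in auto)
  then show ?thesis using assms(1) by (simp add: L2_iff)
qed

lemma L2_scale: assumes "f \<in> L2" shows "(\<lambda>x. c * f x) \<in> L2"
  using assms by (auto simp: L2_iff norm_mult power_mult_distrib)

lemma cmod_add_sq_le: "(cmod (a + b))\<^sup>2 \<le> 2 * (cmod a)\<^sup>2 + 2 * (cmod b)\<^sup>2"
proof -
  have "(cmod (a + b))\<^sup>2 \<le> (cmod a + cmod b)\<^sup>2"
    by (intro power_mono norm_triangle_ineq norm_ge_zero)
  also have "\<dots> \<le> 2 * (cmod a)\<^sup>2 + 2 * (cmod b)\<^sup>2"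
    using sum_squares_bound[of "cmod a" "cmod b"] by (simp add: power2_sum)
  finally show ?thesis .
qed

lemma L2_add: assumes "f \<in> L2" "g \<in> L2" shows "(\<lambda>x. f x + g x) \<in> L2"
proof (rule L2_bound)
  show "integrable lebesgue (\<lambda>x. 2 * (cmod (f x))\<^sup>2 + 2 * (cmod (g x))\<^sup>2)"
    using assms by (simp add: L2_iff)
  show "(\<lambda>x. f x + g x) \<in> borel_measurable lebesgue" using assms by (auto simp: L2_iff)
qed (use cmod_add_sq_le in auto)

lemma L2_diff: assumes "f \<in> L2" "g \<in> L2" shows "(\<lambda>x. f x - g x) \<in> L2"
  using L2_add[OF assms(1) L2_scale[OF assms(2), of "-1"]] by simp

lemma L2_zero: "(\<lambda>x. 0) \<in> L2"
  by (simp add: L2_iff)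

lemma L2_prod_integrable:
  assumes "f \<in> L2" "g \<in> L2" shows "integrable lebesgue (\<lambda>x. f x * g x)"
proof (rule Bochner_Integration.integrable_bound)
  show "integrable lebesgue (\<lambda>x. (cmod (f x))\<^sup>2 + (cmod (g x))\<^sup>2)"
    using assms by (simp add: L2_iff)
  show "(\<lambda>x. f x * g x) \<in> borel_measurable lebesgue" using assms by (auto simp: L2_iff)
  have "cmod a * cmod b \<le> (cmod a)\<^sup>2 + (cmod b)\<^sup>2" for a b
    using sum_squares_bound[of "cmod a" "cmod b"] mult_nonneg_nonneg[of "cmod a" "cmod b"]
    by (simp del: mult_nonneg_nonneg zero_le_mult_iff)
  then show "AE x in lebesgue. norm (f x * g x) \<le> norm ((cmod (f x))\<^sup>2 + (cmod (g x))\<^sup>2)"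
    by (simp add: norm_mult)
qed

lemma L2_cnj: "f \<in> L2 \<Longrightarrow> (\<lambda>x. cnj (f x)) \<in> L2"
  by (auto simp: L2_iff intro!: measurable_compose[of f lebesgue borel cnj]
      borel_measurable_continuous_onI continuous_intros)

lemma L2_inner_integrable:
  "f \<in> L2 \<Longrightarrow> g \<in> L2 \<Longrightarrow> integrable lebesgue (\<lambda>x. f x * cnj (g x))"
  by (intro L2_prod_integrable L2_cnj)

lemma L2_inner_cnj: "L2_inner g f = cnj (L2_inner f g)"
proof -
  have "cnj (L2_inner f g) = (LINT x|lebesgue. cnj (f x * cnj (g x)))"
    unfolding L2_inner_def by (rule Bochner_Integration.integral_cnj[symmetric])
  then show ?thesis by (simp add: L2_inner_def mult.commute)
qed

lemma L2_inner_diff_left: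
  "f \<in> L2 \<Longrightarrow> g \<in> L2 \<Longrightarrow> h \<in> L2 \<Longrightarrow> L2_inner (\<lambda>x. f x - g x) h = L2_inner f h - L2_inner g h"
  unfolding L2_inner_def
  by (subst Bochner_Integration.integral_diff[symmetric])
     (auto intro: L2_inner_integrable simp: left_diff_distrib)

lemma L2_inner_add_left:
  "f \<in> L2 \<Longrightarrow> g \<in> L2 \<Longrightarrow> h \<in> L2 \<Longrightarrow> L2_inner (\<lambda>x. f x + g x) h = L2_inner f h + L2_inner g h"
  unfolding L2_inner_def
  by (subst Bochner_Integration.integral_add[symmetric])
     (auto intro: L2_inner_integrable simp: distrib_right)

lemma L2_inner_scale_left: "L2_inner (\<lambda>x. c * f x) h = c * L2_inner f h"
  unfolding L2_inner_def by (simp add: mult.assoc)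

lemma L2_inner_diff_right:
  "f \<in> L2 \<Longrightarrow> g \<in> L2 \<Longrightarrow> h \<in> L2 \<Longrightarrow> L2_inner h (\<lambda>x. f x - g x) = L2_inner h f - L2_inner h g"
  using L2_inner_diff_left[of f g h] by (metis L2_inner_cnj complex_cnj_diff)

lemma L2_inner_scale_right: "L2_inner h (\<lambda>x. c * f x) = cnj c * L2_inner h f"
  using L2_inner_scale_left[of c f h] by (metis L2_inner_cnj complex_cnj_mult)

lemma L2_inner_zero_left [simp]: "L2_inner (\<lambda>x. 0) h = 0"
  by (simp add: L2_inner_def)

lemma L2_inner_cong:
  assumes "eq_ae f f'" "eq_ae g g'" "f \<in> L2" "f' \<in> L2" "g \<in> L2" "g' \<in> L2"
  shows "L2_inner f g = L2_inner f' g'"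
  unfolding L2_inner_def
  by (rule integral_cong_AE)
     (use assms L2_inner_integrable in \<open>auto simp: eq_ae_def intro!: borel_measurable_integrable\<close>)

lemma eq_ae_refl [simp]: "eq_ae f f" by (simp add: eq_ae_def)
lemma eq_ae_sym: "eq_ae f g \<Longrightarrow> eq_ae g f" unfolding eq_ae_def by auto
lemma eq_ae_trans [trans]: "eq_ae f g \<Longrightarrow> eq_ae g h \<Longrightarrow> eq_ae f h" unfolding eq_ae_def by auto

definition L2_sq :: "fn4 \<Rightarrow> real" where
  "L2_sq f = (LINT x|lebesgue. (cmod (f x))\<^sup>2)"

lemma L2_sq_nonneg: "0 \<le> L2_sq f" by (simp add: L2_sq_def)

lemma L2_inner_self: "L2_inner f f = of_real (L2_sq f)"
  unfolding L2_inner_def L2_sq_def complex_norm_square[symmetric]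
  by (simp add: integral_complex_of_real[symmetric])

lemma L2_sq_eq_0:
  assumes "f \<in> L2" "L2_sq f = 0" shows "eq_ae f (\<lambda>x. 0)"
  using assms integral_nonneg_eq_0_iff_AE[OF L2_integrable[OF assms(1)]]
  by (simp add: L2_sq_def eq_ae_def)

lemma L2_sq_diff_scale:
  assumes "u \<in> L2" "h \<in> L2"
  shows "L2_sq (\<lambda>x. u x - c * h x) = L2_sq u - 2 * Re (cnj c * L2_inner u h) + (cmod c)\<^sup>2 * L2_sq h"
proof -
  have ch: "(\<lambda>x. c * h x) \<in> L2" using assms by (intro L2_scale)
  have "complex_of_real (L2_sq (\<lambda>x. u x - c * h x))
      = L2_inner (\<lambda>x. u x - c * h x) (\<lambda>x. u x - c * h x)" by (simp add: L2_inner_self)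
  also have "\<dots> = L2_inner u u - cnj c * L2_inner u h - (c * L2_inner h u - c * (cnj c * L2_inner h h))"
    using assms ch by (simp add: L2_inner_diff_left L2_inner_diff_right L2_inner_scale_left
        L2_inner_scale_right L2_diff right_diff_distrib)
  also have "\<dots> = of_real (L2_sq u) - (cnj c * L2_inner u h + cnj (cnj c * L2_inner u h))
      + of_real ((cmod c)\<^sup>2) * of_real (L2_sq h)"
    by (simp add: L2_inner_self L2_inner_cnj[of h u] complex_norm_square[simplified] algebra_simps)
  also have "\<dots> = of_real (L2_sq u - 2 * Re (cnj c * L2_inner u h) + (cmod c)\<^sup>2 * L2_sq h)"
    unfolding complex_add_cnj by simp
  finally show ?thesis using of_real_eq_iff by blast
qed

lemma L2_Cauchy_Schwarz:
  assumes "u \<in> L2" "h \<in> L2"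
  shows "(cmod (L2_inner u h))\<^sup>2 \<le> L2_sq u * L2_sq h"
proof (cases "L2_sq h = 0")
  case True
  then have "eq_ae h (\<lambda>x. 0)" using assms L2_sq_eq_0 by blast
  then have "L2_inner u h = L2_inner u (\<lambda>x. 0)"
    using assms L2_zero by (intro L2_inner_cong) auto
  then show ?thesis using True by (simp add: L2_inner_def)
next
  case False
  define s where "s = L2_sq h"
  have s: "s > 0" using False L2_sq_nonneg[of h] by (simp add: s_def)
  define z where "z = L2_inner u h"
  define c where "c = z / of_real s"
  have "0 \<le> L2_sq (\<lambda>x. u x - c * h x)" by (rule L2_sq_nonneg)
  also have "\<dots> = L2_sq u - 2 * Re (cnj c * z) + (cmod c)\<^sup>2 * s"
    unfolding s_def z_def by (rule L2_sq_diff_scale[OF assms])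
  also have "cnj c * z = of_real ((cmod z)\<^sup>2 / s)"
    unfolding c_def by (simp add: complex_norm_square[simplified] mult.commute)
  also have "(cmod c)\<^sup>2 * s = (cmod z)\<^sup>2 / s"
    using s by (simp add: c_def norm_divide power_divide power2_eq_square)
  finally have "(cmod z)\<^sup>2 / s \<le> L2_sq u" by simp
  then show ?thesis using s by (simp add: z_def s_def field_simps)
qed

lemma L2_sq_parallelogram:
  assumes "a \<in> L2" "b \<in> L2"
  shows "L2_sq (\<lambda>x. a x - b x) + L2_sq (\<lambda>x. a x + b x) = 2 * L2_sq a + 2 * L2_sq b"
  using L2_sq_diff_scale[OF assms, of 1] L2_sq_diff_scale[OF assms, of "-1"] by simp

text \<open>
Completeness in the form needed for minimising sequences. The function
\<open>S = (\<Sum>k. 4 ^ k * |g (Suc k) - g k|\<^sup>2)\<close> is integrable because the factor \<open>4 ^ k\<close> still leaves a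
geometric series, and it dominates everything: where it is finite, \<open>g\<close> converges and
\<open>|f - g n|\<^sup>2 \<le> 4 S / 4 ^ n\<close>, so convergence in norm needs no further limit theorem.
\<close>

theorem L2_fast_Cauchy_converges:
  fixes g :: "nat \<Rightarrow> fn4"
  assumes g: "\<And>n. g n \<in> L2"
    and fast: "\<And>n. L2_sq (\<lambda>x. g (Suc n) x - g n x) \<le> C * (1/8) ^ n"
  shows "\<exists>f\<in>L2. (\<lambda>n. L2_sq (\<lambda>x. f x - g n x)) \<longlonglongrightarrow> 0"
proof -
  have [measurable]: "g n \<in> borel_measurable lebesgue" for n using g L2_measurable by blast
  define t where "t k x = 4 ^ k * (cmod (g (Suc k) x - g k x))\<^sup>2" for k x
  define S where "S x = (\<Sum>k. t k x)" for x
  have t_nonneg: "0 \<le> t k x" for k x by (simp add: t_def)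
  have t_int: "integrable lebesgue (t k)" for k
    unfolding t_def using L2_integrable[OF L2_diff[OF g g]] by simp
  have [measurable]: "t k \<in> borel_measurable lebesgue" for k using t_int by auto
  have t_le: "(LINT x|lebesgue. t k x) \<le> C * (1/2) ^ k" for k
  proof -
    have "(LINT x|lebesgue. t k x) = 4 ^ k * L2_sq (\<lambda>x. g (Suc k) x - g k x)"
      by (simp add: t_def L2_sq_def)
    also have "\<dots> \<le> 4 ^ k * (C * (1/8) ^ k)" by (intro mult_left_mono fast) auto
    also have "\<dots> = C * (4 * (1/8)) ^ k" unfolding power_mult_distrib by simp
    finally show ?thesis by simp
  qed
  have nn_t: "(\<integral>\<^sup>+x. ennreal (t k x) \<partial>lebesgue) \<le> ennreal (C * (1/2) ^ k)" for k
    by (subst nn_integral_eq_integral) (auto simp: t_int t_nonneg intro!: ennreal_leI t_le)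
  have C: "C \<ge> 0" using fast[of 0] L2_sq_nonneg[of "\<lambda>x. g (Suc 0) x - g 0 x"] by simp
  have nn_S: "(\<integral>\<^sup>+x. (\<Sum>k. ennreal (t k x)) \<partial>lebesgue) < \<infinity>"
  proof -
    have "(\<integral>\<^sup>+x. (\<Sum>k. ennreal (t k x)) \<partial>lebesgue) = (\<Sum>k. \<integral>\<^sup>+x. ennreal (t k x) \<partial>lebesgue)"
      by (rule nn_integral_suminf) simp
    also have "\<dots> \<le> (\<Sum>k. ennreal (C * (1/2) ^ k))" by (intro suminf_le nn_t) auto
    also have "\<dots> = ennreal (\<Sum>k. C * (1/2) ^ k)"
      by (rule suminf_ennreal2) (auto intro!: summable_mult summable_geometric simp: C)
    also have "\<dots> < \<infinity>" by simp
    finally show ?thesis .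
  qed
  have ae_sum: "AE x in lebesgue. summable (\<lambda>k. t k x)"
  proof -
    have "AE x in lebesgue. (\<Sum>k. ennreal (t k x)) \<noteq> \<infinity>"
      by (rule nn_integral_PInf_AE) (use nn_S in auto)
    then show ?thesis
    proof eventually_elim
      case (elim x)
      then show ?case by (intro summable_suminf_not_top t_nonneg) simp
    qed
  qed
  have [measurable]: "S \<in> borel_measurable lebesgue"
    unfolding S_def by measurable
  have S_int: "integrable lebesgue S"
  proof (rule integrableI_bounded)
    have "(\<integral>\<^sup>+x. ennreal (norm (S x)) \<partial>lebesgue) = (\<integral>\<^sup>+x. (\<Sum>k. ennreal (t k x)) \<partial>lebesgue)"
    proof (rule nn_integral_cong_AE, use ae_sum in eventually_elim)
      case (elim x)
      have "0 \<le> S x" unfolding S_def using elim t_nonneg by (intro suminf_nonneg)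
      then have "ennreal (norm (S x)) = ennreal (\<Sum>k. t k x)" by (simp add: S_def)
      also have "\<dots> = (\<Sum>k. ennreal (t k x))"
        by (rule suminf_ennreal2[symmetric, OF t_nonneg elim])
      finally show ?case .
    qed
    then show "(\<integral>\<^sup>+x. ennreal (norm (S x)) \<partial>lebesgue) < \<infinity>" using nn_S by simp
  qed simp
  define f where "f x = lim (\<lambda>n. g n x)" for x
  have [measurable]: "f \<in> borel_measurable lebesgue"
    unfolding f_def by (rule borel_measurable_lim_metric) simp
  \<comment> \<open>The increments are at most \<open>sqrt (S x) / 2 ^ k\<close>, so the telescoping series is geometric.\<close>
  have ptwise: "(cmod (f x - g n x))\<^sup>2 \<le> 4 * S x * (1/4) ^ n" if sm: "summable (\<lambda>k. t k x)" for x n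
  proof -
    define r where "r = sqrt (S x)"
    have S_nn: "0 \<le> S x" unfolding S_def using sm t_nonneg by (intro suminf_nonneg)
    have half: "((1/2::real) ^ k)\<^sup>2 = (1/4) ^ k" for k
      by (simp add: power2_eq_square flip: power_mult_distrib)
    have inc: "cmod (g (Suc k) x - g k x) \<le> r * (1/2) ^ k" for k
    proof (rule power2_le_imp_le)
      have "t k x \<le> S x" unfolding S_def
        using sum_le_suminf[OF sm, of "{k}"] t_nonneg by auto
      then have "(cmod (g (Suc k) x - g k x))\<^sup>2 \<le> S x * (1/4) ^ k"
        by (simp add: t_def field_simps)
      also have "\<dots> = (r * (1/2) ^ k)\<^sup>2"
        using S_nn by (simp add: r_def power_mult_distrib half)
      finally show "(cmod (g (Suc k) x - g k x))\<^sup>2 \<le> (r * (1/2) ^ k)\<^sup>2" .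
      show "0 \<le> r * (1/2) ^ k" using S_nn by (simp add: r_def)
    qed
    have sum_r: "summable (\<lambda>k. r * (1/2::real) ^ k)" by (intro summable_mult summable_geometric) auto
    have sum_inc: "summable (\<lambda>k. g (Suc k) x - g k x)"
      by (rule summable_comparison_test[OF _ sum_r]) (use inc in auto)
    have tele: "(\<Sum>k<n. g (Suc k) x - g k x) = g n x - g 0 x" for n
      by (rule sum_lessThan_telescope)
    have "(\<lambda>n. g n x - g 0 x) \<longlonglongrightarrow> (\<Sum>k. g (Suc k) x - g k x)"
      using summable_LIMSEQ[OF sum_inc] unfolding tele .
    then have "(\<lambda>n. (g n x - g 0 x) + g 0 x) \<longlonglongrightarrow> (\<Sum>k. g (Suc k) x - g k x) + g 0 x"
      by (intro tendsto_intros)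
    then have "convergent (\<lambda>n. g n x)" by (auto simp: convergent_def)
    then have lim: "(\<lambda>n. g n x) \<longlonglongrightarrow> f x" by (simp add: f_def convergent_LIMSEQ_iff)
    have step: "cmod (g (n + m) x - g n x) \<le> r * (1/2) ^ n * 2" for m
    proof -
      have "cmod (g (n + m) x - g n x) \<le> r * (1/2) ^ n * (2 - 2 * (1/2) ^ m)"
      proof (induction m)
        case (Suc m)
        have "cmod (g (n + Suc m) x - g n x)
            \<le> cmod (g (n + m) x - g n x) + cmod (g (Suc (n + m)) x - g (n + m) x)"
          using norm_triangle_ineq[of "g (n + m) x - g n x" "g (Suc (n + m)) x - g (n + m) x"]
          by simp
        also have "\<dots> \<le> r * (1/2) ^ n * (2 - 2 * (1/2) ^ m) + r * (1/2) ^ (n + m)"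
          by (intro add_mono Suc inc)
        also have "\<dots> = r * (1/2) ^ n * (2 - 2 * (1/2) ^ Suc m)"
          by (simp add: power_add algebra_simps)
        finally show ?case .
      qed simp
      also have "\<dots> \<le> r * (1/2) ^ n * 2"
        using S_nn by (intro mult_left_mono) (auto simp: r_def)
      finally show ?thesis .
    qed
    have "(\<lambda>m. g (n + m) x) \<longlonglongrightarrow> f x"
      using LIMSEQ_ignore_initial_segment[OF lim, of n] by (simp add: add.commute)
    then have "(\<lambda>m. cmod (g (n + m) x - g n x)) \<longlonglongrightarrow> cmod (f x - g n x)"
      by (intro tendsto_intros)
    then have "cmod (f x - g n x) \<le> r * (1/2) ^ n * 2"
      by (rule LIMSEQ_le_const2) (use step in auto)
    then have "(cmod (f x - g n x))\<^sup>2 \<le> (r * (1/2) ^ n * 2)\<^sup>2" by (intro power_mono) auto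
    also have "\<dots> = 4 * S x * (1/4) ^ n"
      using S_nn by (simp add: r_def power_mult_distrib half)
    finally show ?thesis .
  qed
  have diff_L2: "(\<lambda>x. f x - g n x) \<in> L2" for n
  proof (rule L2_bound)
    show "integrable lebesgue (\<lambda>x. 4 * S x * (1/4) ^ n)" using S_int by simp
    show "AE x in lebesgue. (cmod (f x - g n x))\<^sup>2 \<le> 4 * S x * (1/4) ^ n"
      using ae_sum by eventually_elim (rule ptwise)
  qed measurable
  have f: "f \<in> L2" using L2_add[OF diff_L2[of 0] g[of 0]] by simp
  have rate: "L2_sq (\<lambda>x. f x - g n x) \<le> 4 * (LINT x|lebesgue. S x) * (1/4) ^ n" for n
  proof -
    have "L2_sq (\<lambda>x. f x - g n x) \<le> (LINT x|lebesgue. 4 * S x * (1/4) ^ n)"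
      unfolding L2_sq_def
    proof (rule integral_mono_AE)
      show "AE x in lebesgue. (cmod (f x - g n x))\<^sup>2 \<le> 4 * S x * (1/4) ^ n"
        using ae_sum by eventually_elim (rule ptwise)
    qed (use S_int L2_integrable[OF diff_L2] in auto)
    then show ?thesis by simp
  qed
  have lim0: "(\<lambda>n. 4 * (LINT x|lebesgue. S x) * (1/4) ^ n) \<longlonglongrightarrow> 0"
    by (intro tendsto_mult_right_zero LIMSEQ_power_zero) auto
  have "(\<lambda>n. L2_sq (\<lambda>x. f x - g n x)) \<longlonglongrightarrow> 0"
    by (rule tendsto_sandwich[OF always_eventually always_eventually tendsto_const lim0])
       (simp_all add: L2_sq_nonneg rate)
  with f show ?thesis by blast
qed


section \<open>Orthogonal complements and their projections\<close>

definition orth_compl :: "fn4 set \<Rightarrow> fn4 set" where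
  "orth_compl N = {f \<in> L2. \<forall>h\<in>N. L2_inner f h = 0}"

lemma orth_compl_L2: "orth_compl N \<subseteq> L2" by (auto simp: orth_compl_def)

lemma orth_compl_memD: "f \<in> orth_compl N \<Longrightarrow> f \<in> L2" "f \<in> orth_compl N \<Longrightarrow> h \<in> N \<Longrightarrow> L2_inner f h = 0"
  by (simp_all add: orth_compl_def)

lemma orth_compl_diff:
  assumes "N \<subseteq> L2" "a \<in> orth_compl N" "b \<in> orth_compl N" shows "(\<lambda>x. a x - b x) \<in> orth_compl N"
proof -
  have "L2_inner (\<lambda>x. a x - b x) h = 0" if "h \<in> N" for h
    using assms that by (simp add: orth_compl_memD L2_inner_diff_left subsetD)
  then show ?thesis using assms by (simp add: orth_compl_def L2_diff)
qed

lemma orth_compl_add: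
  assumes "N \<subseteq> L2" "a \<in> orth_compl N" "b \<in> orth_compl N" shows "(\<lambda>x. a x + b x) \<in> orth_compl N"
proof -
  have "L2_inner (\<lambda>x. a x + b x) h = 0" if "h \<in> N" for h
    using assms that by (simp add: orth_compl_memD L2_inner_add_left subsetD)
  then show ?thesis using assms by (simp add: orth_compl_def L2_add)
qed

lemma orth_compl_scale: "a \<in> orth_compl N \<Longrightarrow> (\<lambda>x. c * a x) \<in> orth_compl N"
  by (simp add: orth_compl_def L2_scale L2_inner_scale_left)

lemma orth_compl_cong:
  assumes "N \<subseteq> L2" "a \<in> orth_compl N" "b \<in> L2" "eq_ae a b" shows "b \<in> orth_compl N"
proof -
  have "L2_inner b h = 0" if "h \<in> N" for h
    using L2_inner_cong[of b a h h] assms that by (auto simp: orth_compl_def eq_ae_sym)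
  then show ?thesis using assms by (simp add: orth_compl_def)
qed

lemma orth_compl_closed:
  assumes "N \<subseteq> L2" "f \<in> L2" "\<And>n. g n \<in> orth_compl N"
    and lim: "(\<lambda>n. L2_sq (\<lambda>x. f x - g n x)) \<longlonglongrightarrow> 0"
  shows "f \<in> orth_compl N"
proof -
  have "L2_inner f h = 0" if h: "h \<in> N" for h
  proof -
    have hL: "h \<in> L2" and gL: "g n \<in> L2" for n using h assms orth_compl_L2 by auto
    have "(cmod (L2_inner f h))\<^sup>2 \<le> L2_sq (\<lambda>x. f x - g n x) * L2_sq h" for n
    proof -
      have "L2_inner f h = L2_inner (\<lambda>x. f x - g n x) h"
        using assms(2,3) h hL gL by (simp add: L2_inner_diff_left orth_compl_def)
      then show ?thesis using L2_Cauchy_Schwarz[OF L2_diff[OF assms(2) gL] hL] by simp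
    qed
    moreover have "(\<lambda>n. L2_sq (\<lambda>x. f x - g n x) * L2_sq h) \<longlonglongrightarrow> 0"
      using tendsto_mult_left_zero[OF lim] by simp
    ultimately have "(cmod (L2_inner f h))\<^sup>2 \<le> 0"
      by (intro LIMSEQ_le_const[where X = "\<lambda>n. L2_sq (\<lambda>x. f x - g n x) * L2_sq h"]) auto
    then show ?thesis by simp
  qed
  then show ?thesis using assms(2) by (simp add: orth_compl_def)
qed

text \<open>
A minimising sequence for the distance from \<open>f\<close> is Cauchy by the parallelogram law; choosing
its \<open>n\<close>-th distance within \<open>8\<^sup>-\<^sup>n\<close> of the infimum makes it fast enough for
\<open>L2_fast_Cauchy_converges\<close>. Orthogonality of the residual is the first variation, done along
the sequence: \<open>|\<langle>f - g n, h\<rangle>|\<^sup>2\<close> is at most a multiple of the error \<open>8\<^sup>-\<^sup>n\<close>.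
\<close>

theorem orth_compl_projection_exists:
  assumes N: "N \<subseteq> L2" and f: "f \<in> L2"
  shows "\<exists>g\<in>orth_compl N. \<forall>h\<in>orth_compl N. L2_inner (\<lambda>x. f x - g x) h = 0"
proof -
  define d where "d = Inf ((\<lambda>g. L2_sq (\<lambda>x. f x - g x)) ` orth_compl N)"
  have zero: "(\<lambda>x. 0) \<in> orth_compl N" by (simp add: orth_compl_def L2_zero)
  have L2I: "g \<in> L2" if "g \<in> orth_compl N" for g using that orth_compl_L2 by blast
  have bdd: "bdd_below ((\<lambda>g. L2_sq (\<lambda>x. f x - g x)) ` orth_compl N)"
    by (rule bdd_belowI[of _ 0]) (auto simp: L2_sq_nonneg)
  have d_le: "d \<le> L2_sq (\<lambda>x. f x - g x)" if "g \<in> orth_compl N" for g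
    unfolding d_def by (rule cInf_lower[OF _ bdd]) (use that in auto)
  have "\<exists>g. g \<in> orth_compl N \<and> L2_sq (\<lambda>x. f x - g x) < d + (1/8) ^ n" for n
  proof -
    have "d < d + (1/8) ^ n" by simp
    then show ?thesis
      using cInf_less_iff[OF _ bdd, of "d + (1/8) ^ n"] zero by (auto simp: d_def)
  qed
  then have "\<forall>n. \<exists>g. g \<in> orth_compl N \<and> L2_sq (\<lambda>x. f x - g x) < d + (1/8) ^ n" by (rule allI)
  from choice[OF this] obtain g where g: "\<And>n. g n \<in> orth_compl N"
    and g_min: "\<And>n. L2_sq (\<lambda>x. f x - g n x) < d + (1/8) ^ n" by blast
  have fast: "L2_sq (\<lambda>x. g (Suc n) x - g n x) \<le> 4 * (1/8) ^ n" for n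
  proof -
    define a where "a x = f x - g n x" for x
    define b where "b x = f x - g (Suc n) x" for x
    have ab: "a \<in> L2" "b \<in> L2" unfolding a_def b_def using f g L2I L2_diff by auto
    define m where "m x = (1/2) * (g n x + g (Suc n) x)" for x
    have m: "m \<in> orth_compl N" unfolding m_def by (intro orth_compl_scale orth_compl_add N g)
    have "L2_sq (\<lambda>x. a x + b x) = 4 * L2_sq (\<lambda>x. f x - m x)"
    proof -
      have "a x + b x = 2 * (f x - m x)" for x by (simp add: a_def b_def m_def algebra_simps)
      then show ?thesis by (simp only: L2_sq_def norm_mult power_mult_distrib) simp
    qed
    moreover have "(\<lambda>x. a x - b x) = (\<lambda>x. g (Suc n) x - g n x)" by (auto simp: a_def b_def)
    ultimately have "L2_sq (\<lambda>x. g (Suc n) x - g n x)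
        = 2 * L2_sq a + 2 * L2_sq b - 4 * L2_sq (\<lambda>x. f x - m x)"
      using L2_sq_parallelogram[OF ab] by simp
    also have "\<dots> \<le> 2 * (d + (1/8) ^ n) + 2 * (d + (1/8) ^ Suc n) - 4 * d"
      using g_min[of n] g_min[of "Suc n"] d_le[OF m] unfolding a_def b_def by (intro diff_mono add_mono) simp_all
    also have "\<dots> \<le> 4 * (1/8) ^ n" by simp
    finally show ?thesis .
  qed
  obtain p where p: "p \<in> L2" and lim: "(\<lambda>n. L2_sq (\<lambda>x. p x - g n x)) \<longlonglongrightarrow> 0"
    using L2_fast_Cauchy_converges[of g, OF L2I[OF g] fast] by blast
  have p_ann: "p \<in> orth_compl N" by (rule orth_compl_closed[OF N p g lim])
  have "L2_inner (\<lambda>x. f x - p x) h = 0" if h: "h \<in> orth_compl N" for h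
  proof -
    define z where "z n = L2_inner (\<lambda>x. f x - g n x) h" for n
    \<comment> \<open>Adding one keeps the divisor positive when \<open>h\<close> vanishes almost everywhere.\<close>
    define s where "s = L2_sq h + 1"
    have s: "s \<ge> 1" and hs: "L2_sq h \<le> s" using L2_sq_nonneg[of h] by (auto simp: s_def)
    have small: "(cmod (z n))\<^sup>2 \<le> s * (1/8) ^ n" for n
    proof -
      \<comment> \<open>The direction \<open>h\<close> is followed with the step that is optimal when \<open>\<parallel>h\<parallel>\<^sup>2 = s\<close>.\<close>
      define c where "c = z n / of_real s"
      have "(\<lambda>x. g n x + c * h x) \<in> orth_compl N" by (intro orth_compl_add orth_compl_scale N g h)
      from d_le[OF this] have "d \<le> L2_sq (\<lambda>x. (f x - g n x) - c * h x)"
        by (simp add: algebra_simps)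
      also have "\<dots> = L2_sq (\<lambda>x. f x - g n x) - 2 * Re (cnj c * z n) + (cmod c)\<^sup>2 * L2_sq h"
        unfolding z_def by (rule L2_sq_diff_scale) (use f g h L2I L2_diff in auto)
      also have "cnj c * z n = of_real ((cmod (z n))\<^sup>2 / s)"
        unfolding c_def by (simp add: complex_norm_square[simplified] mult.commute)
      also have "(cmod c)\<^sup>2 * L2_sq h \<le> (cmod c)\<^sup>2 * s" using hs by (intro mult_left_mono) auto
      also have "(cmod c)\<^sup>2 * s = (cmod (z n))\<^sup>2 / s"
        using s by (simp add: c_def norm_divide power_divide power2_eq_square)
      finally have "(cmod (z n))\<^sup>2 / s \<le> (1/8) ^ n" using g_min[of n] by simp
      then show ?thesis using s by (simp add: field_simps)
    qed
    have s0: "(\<lambda>n. s * (1/8) ^ n) \<longlonglongrightarrow> 0"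
      by (intro tendsto_mult_right_zero LIMSEQ_power_zero) auto
    have "(\<lambda>n. (cmod (z n))\<^sup>2) \<longlonglongrightarrow> 0"
      by (rule tendsto_sandwich[OF always_eventually always_eventually tendsto_const s0])
         (simp_all add: small)
    then have z0: "(\<lambda>n. cmod (z n)) \<longlonglongrightarrow> 0"
      using tendsto_real_sqrt[of "\<lambda>n. (cmod (z n))\<^sup>2" 0] by simp
    have p0: "(\<lambda>n. L2_sq (\<lambda>x. p x - g n x) * L2_sq h) \<longlonglongrightarrow> 0"
      using tendsto_mult_left_zero[OF lim] by simp
    have "(\<lambda>n. (cmod (L2_inner (\<lambda>x. p x - g n x) h))\<^sup>2) \<longlonglongrightarrow> 0"
      by (rule tendsto_sandwich[OF always_eventually always_eventually tendsto_const p0])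
         (simp_all add: L2_Cauchy_Schwarz L2_diff p L2I g h)
    then have w0: "(\<lambda>n. cmod (L2_inner (\<lambda>x. p x - g n x) h)) \<longlonglongrightarrow> 0"
      using tendsto_real_sqrt[of "\<lambda>n. (cmod (L2_inner (\<lambda>x. p x - g n x) h))\<^sup>2" 0] by simp
    have "cmod (L2_inner (\<lambda>x. f x - p x) h)
        \<le> cmod (z n) + cmod (L2_inner (\<lambda>x. p x - g n x) h)" for n
    proof -
      have "L2_inner (\<lambda>x. f x - p x) h = z n - L2_inner (\<lambda>x. p x - g n x) h"
        unfolding z_def using f p g h L2I by (simp add: L2_inner_diff_left)
      then show ?thesis by (simp add: norm_triangle_ineq4)
    qed
    then have "cmod (L2_inner (\<lambda>x. f x - p x) h) \<le> 0 + 0"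
      by (intro LIMSEQ_le_const[OF tendsto_add[OF z0 w0]]) auto
    then show ?thesis by simp
  qed
  then show ?thesis using p_ann by blast
qed


text \<open>
Exhibiting one function with the defining property is enough to know that the choice in
\<open>orth_proj\<close> succeeds, and it determines the value almost everywhere.
\<close>

lemma orth_proj_unique:
  assumes M: "M \<subseteq> L2" "\<And>a b. a \<in> M \<Longrightarrow> b \<in> M \<Longrightarrow> (\<lambda>x. a x - b x) \<in> M"
    and f: "f \<in> L2" and g: "g \<in> M" "\<And>h. h \<in> M \<Longrightarrow> L2_inner (\<lambda>x. f x - g x) h = 0"
  shows "orth_proj M f \<in> M" "\<And>h. h \<in> M \<Longrightarrow> L2_inner (\<lambda>x. f x - orth_proj M f x) h = 0"
    and "eq_ae (orth_proj M f) g"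
proof -
  define p where "p = orth_proj M f"
  have "p \<in> M \<and> (\<forall>h\<in>M. L2_inner (\<lambda>x. f x - p x) h = 0)"
    unfolding p_def orth_proj_def
    by (rule someI[of "\<lambda>g. g \<in> M \<and> (\<forall>h\<in>M. L2_inner (\<lambda>x. f x - g x) h = 0)" g]) (simp add: g)
  then have p: "p \<in> M" "\<And>h. h \<in> M \<Longrightarrow> L2_inner (\<lambda>x. f x - p x) h = 0" by simp_all
  show "orth_proj M f \<in> M" using p(1) by (simp only: p_def)
  show "L2_inner (\<lambda>x. f x - orth_proj M f x) h = 0" if "h \<in> M" for h
    using p(2)[OF that] by (simp only: p_def)
  define e where "e x = p x - g x" for x
  have e: "e \<in> M" unfolding e_def by (rule M(2)[OF p(1) g(1)])
  have L: "p \<in> L2" "g \<in> L2" "e \<in> L2" using M(1) p(1) g(1) e by blast+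
  have "L2_inner e e = L2_inner p e - L2_inner g e"
    using L2_inner_diff_left[OF L] by (simp add: e_def[abs_def])
  also have "\<dots> = L2_inner (\<lambda>x. f x - g x) e - L2_inner (\<lambda>x. f x - p x) e"
    using L f by (simp add: L2_inner_diff_left)
  also have "\<dots> = 0" using p(2)[OF e] g(2)[OF e] by simp
  finally have "L2_sq e = 0" by (simp add: L2_inner_self)
  then have "eq_ae e (\<lambda>x. 0)" using L by (intro L2_sq_eq_0)
  then show "eq_ae (orth_proj M f) g" by (simp add: eq_ae_def e_def p_def)
qed

lemma
  assumes N: "N \<subseteq> L2" and f: "f \<in> L2"
  shows orth_proj_orth_compl_mem: "orth_proj (orth_compl N) f \<in> orth_compl N"
    and orth_proj_orth_compl_orth: "\<And>h. h \<in> orth_compl N \<Longrightarrow> L2_inner (\<lambda>x. f x - orth_proj (orth_compl N) f x) h = 0"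
proof -
  obtain g where g: "g \<in> orth_compl N" "\<And>h. h \<in> orth_compl N \<Longrightarrow> L2_inner (\<lambda>x. f x - g x) h = 0"
    using orth_compl_projection_exists[OF N f] by (elim bexE) simp
  show "orth_proj (orth_compl N) f \<in> orth_compl N"
    by (rule orth_proj_unique(1)[OF orth_compl_L2 _ f g(1)]) (simp_all add: orth_compl_diff N g(2))
  show "L2_inner (\<lambda>x. f x - orth_proj (orth_compl N) f x) h = 0" if "h \<in> orth_compl N" for h
    by (rule orth_proj_unique(2)[OF orth_compl_L2 _ f g(1) _ that]) (simp_all add: orth_compl_diff N g(2))
qed

lemma orth_proj_orth_compl_fix:
  assumes N: "N \<subseteq> L2" and f: "f \<in> L2" and g: "g \<in> orth_compl N" "eq_ae f g"
  shows "eq_ae (orth_proj (orth_compl N) f) g"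
proof (rule orth_proj_unique(3)[OF orth_compl_L2 orth_compl_diff[OF N] f g(1)])
  fix h assume h: "h \<in> orth_compl N"
  have "L2_inner (\<lambda>x. f x - g x) h = L2_inner (\<lambda>x. 0) h"
    using f g h orth_compl_L2[of N] by (intro L2_inner_cong) (auto simp: eq_ae_def L2_zero L2_diff subset_iff)
  then show "L2_inner (\<lambda>x. f x - g x) h = 0" by simp
qed

text \<open>
Equality of sets, not only up to null sets: \<open>range_L2\<close> and orthogonal complements are both
closed under almost-everywhere equality.
\<close>

lemma range_orth_proj_orth_compl:
  assumes N: "N \<subseteq> L2" shows "range_L2 (orth_proj (orth_compl N)) = orth_compl N"
proof (intro equalityI subsetI)
  fix f assume "f \<in> range_L2 (orth_proj (orth_compl N))"
  then obtain g where g: "f \<in> L2" "g \<in> L2" "eq_ae f (orth_proj (orth_compl N) g)"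
    by (auto simp: range_L2_def)
  show "f \<in> orth_compl N"
    by (rule orth_compl_cong[OF N orth_proj_orth_compl_mem[OF N g(2)] g(1) eq_ae_sym[OF g(3)]])
next
  fix f assume f: "f \<in> orth_compl N"
  then have "f \<in> L2" using orth_compl_L2 by blast
  moreover have "eq_ae f (orth_proj (orth_compl N) f)"
    by (rule eq_ae_sym, rule orth_proj_orth_compl_fix[OF N \<open>f \<in> L2\<close> f eq_ae_refl])
  ultimately show "f \<in> range_L2 (orth_proj (orth_compl N))" unfolding range_L2_def by blast
qed

section \<open>A uniform weighted integral bound\<close>

lemma borel_measurable_lebesgueI:
  "f \<in> borel_measurable borel \<Longrightarrow> f \<in> borel_measurable lebesgue"
  by (rule measurable_completion) simp

lemma dyadic_scale:
  assumes "1 \<le> (t::real)" shows "\<exists>n. 2 ^ n \<le> t \<and> t < 2 ^ Suc n"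
proof -
  obtain m where m: "t < 2 ^ m" using real_arch_pow[of 2 t] by auto
  define n where "n = (LEAST m. t < 2 ^ m)"
  have n: "t < 2 ^ n" unfolding n_def by (rule LeastI[of _ m]) (rule m)
  then have "n \<noteq> 0" using assms by (cases n) auto
  then obtain k where k: "n = Suc k" by (cases n) auto
  then have "\<not> t < 2 ^ k" unfolding n_def by (intro not_less_Least) (simp add: n_def)
  then show ?thesis using n k by (intro exI[of _ k]) auto
qed

text \<open>
A layer-cake estimate in place of polar coordinates: radial functions are dominated by a sum of
multiples of indicators of dyadic balls, whose volumes are known.
\<close>

lemma nn_integral_le_sum_balls:
  fixes f :: "real^4 \<Rightarrow> ennreal"
  assumes f: "\<And>y. f y \<noteq> 0 \<Longrightarrow> \<exists>n. f y \<le> ennreal (a n) \<and> y \<in> cball x (r n)"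
    and nonneg: "\<And>n. 0 \<le> a n" "\<And>n. 0 \<le> r n"
    and sums: "summable (\<lambda>n. a n * r n ^ 4)"
  shows "(\<integral>\<^sup>+y. f y \<partial>lebesgue) \<le> ennreal (unit_ball_vol 4 * (\<Sum>n. a n * r n ^ 4))"
proof -
  have [measurable]: "cball x (r n) \<in> sets borel" for n by simp
  have "(\<integral>\<^sup>+y. f y \<partial>lebesgue) \<le> (\<integral>\<^sup>+y. (\<Sum>n. ennreal (a n) * indicator (cball x (r n)) y) \<partial>lebesgue)"
  proof (rule nn_integral_mono)
    fix y
    show "f y \<le> (\<Sum>n. ennreal (a n) * indicator (cball x (r n)) y)"
    proof (cases "f y = 0")
      case False
      then obtain n where n: "f y \<le> ennreal (a n)" "y \<in> cball x (r n)" using f by blast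
      then have "f y \<le> (\<Sum>i\<in>{n}. ennreal (a i) * indicator (cball x (r i)) y)" by simp
      also have "\<dots> \<le> (\<Sum>i. ennreal (a i) * indicator (cball x (r i)) y)"
        by (rule sum_le_suminf) auto
      finally show ?thesis .
    qed simp
  qed
  also have "\<dots> = (\<Sum>n. \<integral>\<^sup>+y. ennreal (a n) * indicator (cball x (r n)) y \<partial>lebesgue)"
    by (intro nn_integral_suminf borel_measurable_lebesgueI) measurable
  also have "\<dots> = (\<Sum>n. ennreal (unit_ball_vol 4 * (a n * r n ^ 4)))"
  proof (intro suminf_cong)
    fix n
    have "(\<integral>\<^sup>+y. ennreal (a n) * indicator (cball x (r n)) y \<partial>lebesgue)
        = ennreal (a n) * emeasure lborel (cball x (r n))"
      by (subst nn_integral_cmult_indicator) auto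
    also have "\<dots> = ennreal (unit_ball_vol 4 * (a n * r n ^ 4))"
      using nonneg by (simp add: emeasure_cball ennreal_mult'[symmetric] mult_ac)
    finally show "(\<integral>\<^sup>+y. ennreal (a n) * indicator (cball x (r n)) y \<partial>lebesgue)
        = ennreal (unit_ball_vol 4 * (a n * r n ^ 4))" .
  qed
  also have "\<dots> = ennreal (\<Sum>n. unit_ball_vol 4 * (a n * r n ^ 4))"
    by (rule suminf_ennreal2) (auto intro!: summable_mult sums mult_nonneg_nonneg nonneg zero_le_power)
  also have "(\<Sum>n. unit_ball_vol 4 * (a n * r n ^ 4)) = unit_ball_vol 4 * (\<Sum>n. a n * r n ^ 4)"
    by (rule suminf_mult[OF sums])
  finally show ?thesis .
qed

definition weight :: "real \<Rightarrow> real^4 \<Rightarrow> real" where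
  "weight \<delta> y = (1 + norm y) powr (- 4 - \<delta>)"

lemma weight_nonneg: "0 \<le> weight \<delta> y" by (simp add: weight_def)

lemma weight_le_1: "\<delta> > 0 \<Longrightarrow> weight \<delta> y \<le> 1"
  using powr_mono[of "- 4 - \<delta>" 0 "1 + norm y"] by (simp add: weight_def split: if_splits)

lemma weight_measurable [measurable]: "weight \<delta> \<in> borel_measurable lebesgue"
  unfolding weight_def[abs_def] by (rule borel_measurable_lebesgueI) measurable

lemma nn_integral_weight:
  assumes "\<delta> > 0"
  shows "\<exists>K\<ge>0. (\<integral>\<^sup>+y. ennreal (weight \<delta> y) \<partial>lebesgue) \<le> ennreal K"
proof -
  define a where "a n = (2 ^ n) powr (- 4 - \<delta>)" for n
  define r :: "nat \<Rightarrow> real" where "r n = 2 ^ Suc n" for n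
  have eq: "a n * r n ^ 4 = 16 * (2 powr (-\<delta>)) ^ n" for n
  proof -
    have "a n * r n ^ 4 = 16 * ((2 powr real n) powr (- 4 - \<delta>) * (2 powr real n) powr 4)"
      by (simp add: a_def r_def powr_realpow power_mult_distrib)
    also have "\<dots> = 16 * (2 powr real n) powr (- \<delta>)"
      by (subst powr_add[symmetric]) simp
    also have "\<dots> = 16 * (2 powr (-\<delta>)) ^ n"
      by (simp add: powr_powr powr_realpow[symmetric] mult.commute)
    finally show ?thesis .
  qed
  have sums: "summable (\<lambda>n. a n * r n ^ 4)"
    unfolding eq using assms by (intro summable_mult summable_geometric) (simp add: powr_less_one)
  have "(\<integral>\<^sup>+y. ennreal (weight \<delta> y) \<partial>lebesgue) \<le> ennreal (unit_ball_vol 4 * (\<Sum>n. a n * r n ^ 4))"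
  proof (rule nn_integral_le_sum_balls[OF _ _ _ sums, where x = 0])
    fix y :: "real^4"
    obtain n where n: "2 ^ n \<le> 1 + norm y" "1 + norm y < 2 ^ Suc n"
      using dyadic_scale[of "1 + norm y"] by auto
    have "weight \<delta> y \<le> a n"
      unfolding weight_def a_def using n assms by (intro powr_mono2') auto
    moreover have "y \<in> cball 0 (r n)" using n by (simp add: r_def)
    ultimately show "\<exists>n. ennreal (weight \<delta> y) \<le> ennreal (a n) \<and> y \<in> cball 0 (r n)"
      by (auto intro: ennreal_leI)
  qed (auto simp: a_def r_def)
  moreover have "0 \<le> unit_ball_vol 4 * (\<Sum>n. a n * r n ^ 4)"
    by (intro mult_nonneg_nonneg suminf_nonneg sums) (auto simp: a_def r_def)
  ultimately show ?thesis by blast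
qed

lemma nn_integral_inverse_square_ball:
  "\<exists>K\<ge>0. \<forall>x::real^4. (\<integral>\<^sup>+y. ennreal (if norm (x - y) < 1 then 1 / (norm (x - y))\<^sup>2 else 0) \<partial>lebesgue) \<le> ennreal K"
proof -
  define a :: "nat \<Rightarrow> real" where "a n = 4 * 4 ^ n" for n
  define r :: "nat \<Rightarrow> real" where "r n = (1/2) ^ n" for n
  have eq: "a n * r n ^ 4 = 4 * (1/4) ^ n" for n
  proof -
    have "a n * r n ^ 4 = 4 * (4 ^ n * ((1/2) ^ 4) ^ n)"
      by (simp only: a_def r_def power_mult[symmetric] mult.commute[of n] mult.assoc)
    also have "\<dots> = 4 * (4 * (1/2) ^ 4) ^ n" by (simp only: power_mult_distrib)
    also have "4 * (1/2) ^ 4 = (1/4 :: real)" by (simp add: power_divide)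
    finally show ?thesis .
  qed
  have sums: "summable (\<lambda>n. a n * r n ^ 4)"
    unfolding eq by (intro summable_mult summable_geometric) simp
  have "(\<integral>\<^sup>+y. ennreal (if norm (x - y) < 1 then 1 / (norm (x - y))\<^sup>2 else 0) \<partial>lebesgue)
      \<le> ennreal (unit_ball_vol 4 * (\<Sum>n. a n * r n ^ 4))" for x :: "real^4"
  proof (rule nn_integral_le_sum_balls[OF _ _ _ sums, where x = x])
    fix y :: "real^4"
    assume "ennreal (if norm (x - y) < 1 then 1 / (norm (x - y))\<^sup>2 else 0) \<noteq> 0"
    then have d: "0 < norm (x - y)" "norm (x - y) < 1" by (auto split: if_splits)
    obtain n where n: "2 ^ n \<le> 1 / norm (x - y)" "1 / norm (x - y) < 2 ^ Suc n"
      using dyadic_scale[of "1 / norm (x - y)"] d by auto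
    have "1 / (norm (x - y))\<^sup>2 = (1 / norm (x - y))\<^sup>2" by (simp add: power_divide)
    also have "\<dots> \<le> (2 ^ Suc n)\<^sup>2" using n d by (intro power_mono) auto
    also have "\<dots> = a n" by (simp add: a_def power_mult_distrib power_mult power2_eq_square flip: power_mult_distrib)
    finally have "1 / (norm (x - y))\<^sup>2 \<le> a n" .
    moreover have "y \<in> cball x (r n)"
      using n(1) d by (simp add: r_def dist_norm power_divide field_simps)
    ultimately show "\<exists>n. ennreal (if norm (x - y) < 1 then 1 / (norm (x - y))\<^sup>2 else 0) \<le> ennreal (a n)
        \<and> y \<in> cball x (r n)"
      using d by (auto intro: ennreal_leI)
  qed (auto simp: a_def r_def)
  moreover have "0 \<le> unit_ball_vol 4 * (\<Sum>n. a n * r n ^ 4)"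
    by (intro mult_nonneg_nonneg suminf_nonneg sums) (auto simp: a_def r_def)
  ultimately show ?thesis by blast
qed

text \<open>
Up to powers of \<open>1 + |x|\<close> and \<open>1 + |y|\<close>, this factor majorises all the kernels derived from
\<open>log |x - y|\<close> below. The summand 1 makes it at least 1, so that its powers may be compared.
\<close>

definition inv_dist1 :: "real^4 \<Rightarrow> real^4 \<Rightarrow> real" where
  "inv_dist1 x y = 1 + 1 / norm (x - y)"

lemma inv_dist1_ge_1: "1 \<le> inv_dist1 x y" by (simp add: inv_dist1_def)

lemma inv_dist1_measurable [measurable]: "inv_dist1 x \<in> borel_measurable lebesgue"
  unfolding inv_dist1_def[abs_def] by (rule borel_measurable_lebesgueI) measurable

text \<open>
The singularity \<open>|x - y|\<^sup>-\<^sup>2\<close> is integrable near \<open>x\<close> in dimension four, with an integral over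
the unit ball that does not depend on \<open>x\<close>; at distance 1 or more it is at most 1, and there the
integrable weight suffices.
\<close>

theorem weight_inv_dist_integrable:
  assumes "\<delta> > 0"
  obtains K where "\<And>x. integrable lebesgue (\<lambda>y. weight \<delta> y * (inv_dist1 x y)\<^sup>2)"
    and "\<And>x. (LINT y|lebesgue. weight \<delta> y * (inv_dist1 x y)\<^sup>2) \<le> K"
proof -
  obtain A where A: "A \<ge> 0" "(\<integral>\<^sup>+y. ennreal (weight \<delta> y) \<partial>lebesgue) \<le> ennreal A"
    using nn_integral_weight[OF assms] by blast
  obtain B where B: "B \<ge> 0"
    "\<And>x::real^4. (\<integral>\<^sup>+y. ennreal (if norm (x - y) < 1 then 1 / (norm (x - y))\<^sup>2 else 0) \<partial>lebesgue) \<le> ennreal B"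
    using nn_integral_inverse_square_ball by blast
  define F where "F x y = weight \<delta> y * (inv_dist1 x y)\<^sup>2" for x y
  define h where "h x y = (if norm (x - y) < 1 then 1 / (norm (x - y))\<^sup>2 else 0)" for x y :: "real^4"
  have h_meas [measurable]: "h x \<in> borel_measurable lebesgue" for x
    unfolding h_def[abs_def] by (rule borel_measurable_lebesgueI) measurable
  have F_nonneg: "0 \<le> F x y" for x y by (simp add: F_def weight_nonneg)
  have F_meas: "F x \<in> borel_measurable lebesgue" for x unfolding F_def[abs_def] by measurable
  have F_le: "F x y \<le> 4 * weight \<delta> y + 2 * h x y" for x y
  proof -
    define d where "d = norm (x - y)"
    have d: "d \<ge> 0" by (simp add: d_def)
    have 1: "(inv_dist1 x y)\<^sup>2 \<le> 2 + 2 * (1 / d\<^sup>2)"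
      using sum_squares_bound[of 1 "1 / d"]
      by (simp add: inv_dist1_def d_def[symmetric] power2_sum power_divide)
    have 2: "1 / d\<^sup>2 \<le> 1 + h x y"
    proof (cases "d < 1")
      case False
      then have "1 / d\<^sup>2 \<le> 1" by (simp add: divide_le_eq_1)
      then show ?thesis using False by (simp add: h_def d_def)
    qed (simp add: h_def d_def)
    have "F x y \<le> weight \<delta> y * (4 + 2 * h x y)"
      unfolding F_def using 1 2 by (intro mult_left_mono weight_nonneg) linarith
    also have "\<dots> = 4 * weight \<delta> y + 2 * (weight \<delta> y * h x y)" by (simp add: algebra_simps)
    also have "weight \<delta> y * h x y \<le> 1 * h x y"
      by (intro mult_right_mono weight_le_1 assms) (simp add: h_def)
    finally show ?thesis by simp
  qed
  have nn: "(\<integral>\<^sup>+y. ennreal (F x y) \<partial>lebesgue) \<le> ennreal (4 * A + 2 * B)" for x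
  proof -
    have hn: "0 \<le> h x y" for y by (simp add: h_def)
    have "(\<integral>\<^sup>+y. ennreal (F x y) \<partial>lebesgue)
        \<le> (\<integral>\<^sup>+y. ennreal 4 * ennreal (weight \<delta> y) + ennreal 2 * ennreal (h x y) \<partial>lebesgue)"
    proof (rule nn_integral_mono)
      fix y
      have "ennreal (F x y) \<le> ennreal (4 * weight \<delta> y + 2 * h x y)" by (rule ennreal_leI[OF F_le])
      also have "\<dots> = ennreal 4 * ennreal (weight \<delta> y) + ennreal 2 * ennreal (h x y)"
        using weight_nonneg[of \<delta> y] hn[of y] by (subst ennreal_plus) (auto simp: ennreal_mult')
      finally show "ennreal (F x y) \<le> ennreal 4 * ennreal (weight \<delta> y) + ennreal 2 * ennreal (h x y)" .
    qed
    also have "\<dots> = ennreal 4 * (\<integral>\<^sup>+y. ennreal (weight \<delta> y) \<partial>lebesgue) + ennreal 2 * (\<integral>\<^sup>+y. ennreal (h x y) \<partial>lebesgue)"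
      by (subst nn_integral_add) (auto simp: nn_integral_cmult)
    also have "\<dots> \<le> ennreal 4 * ennreal A + ennreal 2 * ennreal B"
      using A(2) B(2)[of x] by (intro add_mono mult_left_mono) (auto simp: h_def)
    also have "\<dots> = ennreal (4 * A + 2 * B)"
      using A(1) B(1) by (simp add: ennreal_mult' ennreal_plus)
    finally show ?thesis .
  qed
  have "integrable lebesgue (F x)" for x
  proof (rule integrableI_nonneg[OF F_meas])
    show "(\<integral>\<^sup>+y. ennreal (F x y) \<partial>lebesgue) < \<infinity>"
      using nn[of x] by (rule le_less_trans) simp
  qed (simp add: F_nonneg)
  moreover have "(LINT y|lebesgue. F x y) \<le> 4 * A + 2 * B" for x
    by (rule integral_real_bounded[OF _ nn]) (use A B in simp)
  ultimately show ?thesis using that unfolding F_def by blast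
qed

lemma weight_integrable: assumes "\<delta> > 0" shows "integrable lebesgue (weight \<delta>)"
proof -
  obtain K where K: "\<And>x. integrable lebesgue (\<lambda>y. weight \<delta> y * (inv_dist1 x y)\<^sup>2)"
    using weight_inv_dist_integrable[OF assms] by metis
  show ?thesis
  proof (rule Bochner_Integration.integrable_bound[OF K[of 0]])
    have "weight \<delta> y * 1 \<le> weight \<delta> y * (inv_dist1 0 y)\<^sup>2" for y
      by (intro mult_left_mono weight_nonneg one_le_power inv_dist1_ge_1)
    then show "AE y in lebesgue. norm (weight \<delta> y) \<le> norm (weight \<delta> y * (inv_dist1 0 y)\<^sup>2)"
      by (simp add: weight_nonneg)
  qed measurable
qed

section \<open>Pointwise bounds for the logarithmic kernel\<close>

text \<open>
Both signs come from \<open>ln t \<le> t - 1\<close>, for \<open>t = |x - y|\<close> and for its inverse. On the diagonal the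
left-hand side is 0 because \<open>ln 0 = 0\<close>.
\<close>

lemma abs_ln_dist_le: "\<bar>ln (norm (x - y))\<bar> \<le> (1 + norm x) * (1 + norm y) * inv_dist1 x y"
proof (cases "x = y")
  case False
  define d where "d = norm (x - y)"
  have d: "d > 0" using False by (simp add: d_def)
  have "d \<le> norm x + norm y" unfolding d_def by (rule norm_triangle_ineq4)
  moreover have "(1 + norm x) * (1 + norm y) = 1 + (norm x + norm y) + norm x * norm y"
    by (simp add: algebra_simps)
  moreover have "0 \<le> norm x * norm y" by simp
  ultimately have "d \<le> (1 + norm x) * (1 + norm y)" by linarith
  moreover have "1 \<le> (1 + norm x) * (1 + norm y)"
    using mult_mono[of 1 "1 + norm x" 1 "1 + norm y"] by simp
  moreover have "ln d \<le> d" using ln_le_minus_one[OF d] by simp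
  moreover have "- ln d \<le> 1 / d" using ln_le_minus_one[of "1 / d"] d by (simp add: ln_div)
  ultimately have "\<bar>ln d\<bar> \<le> (1 + norm x) * (1 + norm y) + 1 * (1 / d)" "1 \<le> (1 + norm x) * (1 + norm y)"
    using d by (auto simp: abs_le_iff) (smt (verit) divide_pos_pos)+
  moreover have "1 * (1 / d) \<le> (1 + norm x) * (1 + norm y) * (1 / d)"
    using calculation(2) d by (intro mult_right_mono) auto
  ultimately show ?thesis by (simp add: inv_dist1_def d_def[symmetric] distrib_left)
qed (simp add: inv_dist1_def)

text \<open>
Here \<open>ln t \<le> t - 1\<close> is used for \<open>t = |x - y| / (1 + |x|)\<close> and for its inverse, together with
\<open>|x - y| \<le> |x| + |y|\<close> and \<open>|x| - |x - y| \<le> |y|\<close>. For the second bound the factor \<open>1 + |x|\<close> is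
absorbed by \<open>1 + |x| \<le> |x - y| + (1 + |y|)\<close>.
\<close>

lemma
  assumes "x \<noteq> (y :: real^4)"
  shows ln_dist_diff_le: "\<bar>ln (norm (x - y)) - ln (1 + norm x)\<bar> \<le> (1 + norm y) * inv_dist1 x y"
    and ln_dist_diff_decay:
      "(1 + norm x) * \<bar>ln (norm (x - y)) - ln (1 + norm x)\<bar> \<le> (1 + norm y)\<^sup>2 * inv_dist1 x y"
proof -
  define d where "d = norm (x - y)"
  define b where "b = 1 + norm x"
  define c where "c = 1 + norm y"
  have d: "d > 0" and b: "b \<ge> 1" and c: "c \<ge> 1" using assms by (auto simp: d_def b_def c_def)
  have dbc: "d \<le> b + c" "b - d \<le> c"
    using norm_triangle_ineq4[of x y] norm_triangle_ineq2[of x "x - y"] norm_triangle_ineq[of "x - y" y]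
    by (auto simp: d_def b_def c_def)
  have up: "ln d - ln b \<le> c / b"
  proof -
    have "ln d - ln b = ln (d / b)" using d b by (simp add: ln_div)
    also have "\<dots> \<le> d / b - 1" using d b by (intro ln_le_minus_one) auto
    also have "\<dots> = (d - b) / b" using b by (simp add: diff_divide_distrib)
    also have "\<dots> \<le> c / b" using dbc b by (intro divide_right_mono) auto
    finally show ?thesis .
  qed
  have lo: "ln b - ln d \<le> c / d"
  proof -
    have "ln b - ln d = ln (b / d)" using d b by (simp add: ln_div)
    also have "\<dots> \<le> b / d - 1" using d b by (intro ln_le_minus_one) auto
    also have "\<dots> = (b - d) / d" using d by (simp add: diff_divide_distrib)
    also have "\<dots> \<le> c / d" using dbc d by (intro divide_right_mono) auto
    finally show ?thesis .
  qed
  have cb: "c / b \<le> c" using b c by (simp add: field_simps mult_le_cancel_left1)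
  have "\<bar>ln d - ln b\<bar> \<le> c + c / d" using up lo cb c d by (auto simp: abs_le_iff add_increasing add_increasing2)
  then show "\<bar>ln (norm (x - y)) - ln (1 + norm x)\<bar> \<le> (1 + norm y) * inv_dist1 x y"
    by (simp add: inv_dist1_def d_def b_def c_def distrib_left)
  have cc: "c \<le> c\<^sup>2" using c by (simp add: self_le_power)
  have "b * (ln d - ln b) \<le> c"
    using mult_left_mono[OF up, of b] b by simp
  moreover have "b * (ln b - ln d) \<le> c\<^sup>2 + c\<^sup>2 / d"
  proof -
    have "b * (ln b - ln d) \<le> b * (c / d)" using lo b by (intro mult_left_mono) auto
    also have "\<dots> \<le> (d + c) * (c / d)" using dbc c d by (intro mult_right_mono) auto
    also have "\<dots> = c + c\<^sup>2 / d" using d by (simp add: field_simps power2_eq_square)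
    finally show ?thesis using cc by simp
  qed
  moreover have "0 \<le> c\<^sup>2 / d" using d by simp
  ultimately have "\<bar>b * (ln d - ln b)\<bar> \<le> c\<^sup>2 + c\<^sup>2 / d" using cc
    by (auto simp: abs_le_iff right_diff_distrib)
  then have "b * \<bar>ln d - ln b\<bar> \<le> c\<^sup>2 + c\<^sup>2 / d" using b by (simp add: abs_mult)
  then show "(1 + norm x) * \<bar>ln (norm (x - y)) - ln (1 + norm x)\<bar> \<le> (1 + norm y)\<^sup>2 * inv_dist1 x y"
    by (simp add: inv_dist1_def d_def b_def c_def distrib_left)
qed

section \<open>The operator T\<close>

lemma sigma_finite_lebesgue: "sigma_finite_measure (lebesgue :: (real^4) measure)"
proof
  let ?A = "range (\<lambda>n. cball 0 (real n) :: (real^4) set)"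
  have "\<Union> ?A = UNIV" by (auto simp: real_arch_simple)
  moreover have "emeasure lebesgue (cball 0 (real n) :: (real^4) set) \<noteq> \<infinity>" for n
    by (simp add: emeasure_cball)
  ultimately show "\<exists>A. countable A \<and> A \<subseteq> sets (lebesgue :: (real^4) measure)
      \<and> \<Union> A = space lebesgue \<and> (\<forall>a\<in>A. emeasure lebesgue a \<noteq> \<infinity>)"
    by (intro exI[of _ ?A]) auto
qed

lemma log_kernel_measurable [measurable]:
  "(\<lambda>p. complex_of_real (ln (norm (fst p - snd p :: real^4))))
     \<in> borel_measurable (lebesgue \<Otimes>\<^sub>M lebesgue)"
proof -
  have id: "(\<lambda>x :: real^4. x) \<in> borel_measurable lebesgue"
    by (rule borel_measurable_lebesgueI) simp
  have [measurable]: "fst \<in> borel_measurable ((lebesgue :: (real^4) measure) \<Otimes>\<^sub>M (lebesgue :: (real^4) measure))"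
    using measurable_compose[OF measurable_fst[of "lebesgue :: (real^4) measure" "lebesgue :: (real^4) measure"] id] by simp
  have [measurable]: "snd \<in> borel_measurable ((lebesgue :: (real^4) measure) \<Otimes>\<^sub>M (lebesgue :: (real^4) measure))"
    using measurable_compose[OF measurable_snd[of "lebesgue :: (real^4) measure" "lebesgue :: (real^4) measure"] id] by simp
  show ?thesis by measurable
qed

lemma G1_measurable:
  assumes [measurable]: "f \<in> borel_measurable lebesgue"
  shows "G1 f \<in> borel_measurable lebesgue"
proof -
  interpret sigma_finite_measure "lebesgue :: (real^4) measure" by (rule sigma_finite_lebesgue)
  have "(\<lambda>x. LINT y|lebesgue. complex_of_real (ln (norm (x - y))) * f y) \<in> borel_measurable lebesgue"
    by (rule borel_measurable_lebesgue_integral) (simp add: split_beta')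
  then show ?thesis unfolding G1_def[abs_def] by simp
qed

lemma G1_scale: "G1 (\<lambda>y. c * f y) x = c * G1 f x"
  unfolding G1_def by (simp add: mult.left_commute[of _ c])

text \<open>
The decay is stated with \<open>1 + |x|\<close>, which is comparable to \<open>\<langle>x\<rangle>\<close> and multiplies out more simply.
\<close>

locale decaying_potential =
  fixes V :: "real^4 \<Rightarrow> real" and C \<epsilon> :: real
  assumes V_meas: "V \<in> borel_measurable lebesgue"
    and V_nonzero: "\<not> (AE x in lebesgue. V x = 0)"
    and eps: "\<epsilon> > 0"
    and v_le: "\<And>x. rootV V x \<le> C * (1 + norm x) powr (- 3 - \<epsilon>)"
begin

abbreviation v :: "real^4 \<Rightarrow> real" where "v \<equiv> rootV V"
abbreviation vc :: fn4 where "vc \<equiv> \<lambda>x. complex_of_real (rootV V x)"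
abbreviation G1v :: "fn4 \<Rightarrow> fn4" where "G1v f \<equiv> G1 (\<lambda>y. complex_of_real (rootV V y) * f y)"
abbreviation T :: "fn4 \<Rightarrow> fn4" where "T \<equiv> opT V"

lemma v_nonneg: "0 \<le> v x" by (simp add: rootV_def)

lemma v_measurable [measurable]: "v \<in> borel_measurable lebesgue"
  and U_measurable [measurable]: "sgnV V \<in> borel_measurable lebesgue"
  using V_meas unfolding rootV_def[abs_def] sgnV_def[abs_def] by measurable

text \<open>
This is where decay faster than \<open>|x|\<^sup>-\<^sup>3\<close> enters: one power of \<open>1 + |x|\<close> can be spared, and the
square of what is left is still an integrable weight in dimension four.
\<close>

lemma v_weight: "((1 + norm x) * v x)\<^sup>2 \<le> C\<^sup>2 * weight (2 * \<epsilon>) x"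
proof -
  define b where "b = 1 + norm x"
  have b: "b > 0" by (simp add: b_def add_pos_nonneg)
  have "b * v x \<le> b * (C * b powr (- 3 - \<epsilon>))"
    using v_le[of x] b by (intro mult_left_mono) (auto simp: b_def)
  also have "\<dots> = C * (b powr 1 * b powr (- 3 - \<epsilon>))" using b by simp
  also have "\<dots> = C * b powr (- 2 - \<epsilon>)" by (subst powr_add[symmetric]) simp
  finally have "b * v x \<le> C * b powr (- 2 - \<epsilon>)" .
  then have "(b * v x)\<^sup>2 \<le> (C * b powr (- 2 - \<epsilon>))\<^sup>2"
    using b v_nonneg by (intro power_mono) auto
  also have "\<dots> = C\<^sup>2 * (b powr (- 2 - \<epsilon>) * b powr (- 2 - \<epsilon>))"
    by (simp add: power2_eq_square)
  also have "b powr (- 2 - \<epsilon>) * b powr (- 2 - \<epsilon>) = weight (2 * \<epsilon>) x"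
    by (subst powr_add[symmetric]) (simp add: weight_def b_def)
  finally show ?thesis by (simp add: b_def)
qed

lemma weighted_v_L2: "(\<lambda>x. of_real ((1 + norm x) * v x)) \<in> L2" and v_L2: "vc \<in> L2"
proof -
  have int: "integrable lebesgue (\<lambda>x. C\<^sup>2 * weight (2 * \<epsilon>) x)" using eps by (simp add: weight_integrable)
  have [measurable]: "(\<lambda>x :: real^4. norm x) \<in> borel_measurable lebesgue"
    by (rule borel_measurable_lebesgueI) simp
  show "(\<lambda>x. of_real ((1 + norm x) * v x)) \<in> L2"
    by (rule L2_bound[OF _ int], measurable) (simp only: norm_of_real power2_abs v_weight AE_I2)
  have "(v x)\<^sup>2 \<le> C\<^sup>2 * weight (2 * \<epsilon>) x" for x
  proof -
    have "(v x)\<^sup>2 \<le> ((1 + norm x) * v x)\<^sup>2"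
      using v_nonneg[of x] by (intro power_mono) (auto simp: distrib_right)
    then show ?thesis using v_weight[of x] by simp
  qed
  then show "vc \<in> L2" by (intro L2_bound[OF _ int]) auto
qed

text \<open>
The integrand is a product of \<open>(1 + |y|) v(y) \<kappa>(x,y)\<close> and \<open>|f(y)|\<close>, where \<open>\<kappa>\<close> is \<open>inv_dist1\<close>. Both
factors are square integrable, the first uniformly in \<open>x\<close>, so \<open>a c \<le> a\<^sup>2 + c\<^sup>2\<close> is enough.
\<close>

lemma kernel_integrable:
  assumes f: "f \<in> L2"
  obtains A where "A \<ge> 0"
    "\<And>x. integrable lebesgue (\<lambda>y. (1 + norm y) * inv_dist1 x y * (v y * cmod (f y)))"
    "\<And>x. (LINT y|lebesgue. (1 + norm y) * inv_dist1 x y * (v y * cmod (f y))) \<le> A"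
proof -
  obtain K where K: "\<And>x. integrable lebesgue (\<lambda>y. weight (2*\<epsilon>) y * (inv_dist1 x y)\<^sup>2)"
      "\<And>x. (LINT y|lebesgue. weight (2*\<epsilon>) y * (inv_dist1 x y)\<^sup>2) \<le> K"
    using weight_inv_dist_integrable[of "2 * \<epsilon>"] eps by auto
  have [measurable]: "(\<lambda>x :: real^4. norm x) \<in> borel_measurable lebesgue"
    by (rule borel_measurable_lebesgueI) simp
  have [measurable]: "f \<in> borel_measurable lebesgue" by (rule L2_measurable[OF f])
  define F where "F x y = (1 + norm y) * inv_dist1 x y * (v y * cmod (f y))" for x y
  define M where "M x y = C\<^sup>2 * (weight (2*\<epsilon>) y * (inv_dist1 x y)\<^sup>2) + (cmod (f y))\<^sup>2" for x y
  have Mi: "integrable lebesgue (M x)" for x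
    unfolding M_def using K(1) L2_integrable[OF f] by simp
  have F0: "0 \<le> F x y" for x y
    unfolding F_def using v_nonneg[of y] inv_dist1_ge_1[of x y] by (intro mult_nonneg_nonneg) auto
  have FM: "F x y \<le> M x y" for x y
  proof -
    define a where "a = (1 + norm y) * v y * inv_dist1 x y"
    have "a \<ge> 0" unfolding a_def using v_nonneg[of y] inv_dist1_ge_1[of x y]
      by (intro mult_nonneg_nonneg) auto
    then have "a * cmod (f y) \<le> a\<^sup>2 + (cmod (f y))\<^sup>2"
      using sum_squares_bound[of a "cmod (f y)"] mult_nonneg_nonneg[of a "cmod (f y)"]
      by (simp del: mult_nonneg_nonneg)
    also have "a\<^sup>2 \<le> C\<^sup>2 * weight (2*\<epsilon>) y * (inv_dist1 x y)\<^sup>2"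
      unfolding a_def power_mult_distrib[of _ "inv_dist1 x y"]
      by (intro mult_right_mono v_weight) simp
    finally show ?thesis by (simp add: F_def M_def a_def mult_ac)
  qed
  have Fm: "F x \<in> borel_measurable lebesgue" for x unfolding F_def[abs_def] by measurable
  have Fi: "integrable lebesgue (F x)" for x
  proof (rule Bochner_Integration.integrable_bound[OF Mi[of x] Fm], rule AE_I2)
    show "norm (F x y) \<le> norm (M x y)" for y using F0[of x y] FM[of x y] by simp
  qed
  have le: "(LINT y|lebesgue. F x y) \<le> C\<^sup>2 * K + L2_sq f" for x
  proof -
    have "(LINT y|lebesgue. F x y) \<le> (LINT y|lebesgue. M x y)"
      by (rule integral_mono[OF Fi Mi FM])
    also have "\<dots> = C\<^sup>2 * (LINT y|lebesgue. weight (2*\<epsilon>) y * (inv_dist1 x y)\<^sup>2) + L2_sq f"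
      unfolding M_def L2_sq_def using K(1) L2_integrable[OF f] by simp
    also have "\<dots> \<le> C\<^sup>2 * K + L2_sq f" using K(2)[of x] by (intro add_right_mono mult_left_mono) auto
    finally show ?thesis .
  qed
  have "0 \<le> (LINT y|lebesgue. F 0 y)" by (intro integral_nonneg_AE AE_I2 F0)
  then have "0 \<le> C\<^sup>2 * K + L2_sq f" using le[of 0] by linarith
  then show ?thesis using that[of "C\<^sup>2 * K + L2_sq f"] Fi le unfolding F_def[abs_def] by blast
qed

lemma
  assumes f: "f \<in> L2"
  shows log_integrable: "integrable lebesgue (\<lambda>y. complex_of_real (ln (norm (x - y))) * (vc y * f y))"
    and log_integral_growth: "\<exists>A\<ge>0. \<forall>x.
      (LINT y|lebesgue. cmod (complex_of_real (ln (norm (x - y))) * (vc y * f y))) \<le> A * (1 + norm x)"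
proof -
  obtain A where A: "A \<ge> 0"
    and int: "\<And>x. integrable lebesgue (\<lambda>y. (1 + norm y) * inv_dist1 x y * (v y * cmod (f y)))"
    and le: "\<And>x. (LINT y|lebesgue. (1 + norm y) * inv_dist1 x y * (v y * cmod (f y))) \<le> A"
    using kernel_integrable[OF f] by blast
  have [measurable]: "f \<in> borel_measurable lebesgue" by (rule L2_measurable[OF f])
  have [measurable]: "(\<lambda>y. ln (norm (x - y))) \<in> borel_measurable lebesgue" for x :: "real^4"
    by (rule borel_measurable_lebesgueI) measurable
  have bound: "cmod (complex_of_real (ln (norm (x - y))) * (vc y * f y))
      \<le> (1 + norm x) * ((1 + norm y) * inv_dist1 x y * (v y * cmod (f y)))" for x y
    using mult_right_mono[OF abs_ln_dist_le[of x y], of "v y * cmod (f y)"] v_nonneg[of y]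
    by (simp add: norm_mult mult.assoc)
  have log: "integrable lebesgue (\<lambda>y. complex_of_real (ln (norm (x - y))) * (vc y * f y))" for x
  proof (rule Bochner_Integration.integrable_bound)
    show "integrable lebesgue (\<lambda>y. (1 + norm x) * ((1 + norm y) * inv_dist1 x y * (v y * cmod (f y))))"
      using int by simp
    show "AE y in lebesgue. norm (complex_of_real (ln (norm (x - y))) * (vc y * f y))
        \<le> norm ((1 + norm x) * ((1 + norm y) * inv_dist1 x y * (v y * cmod (f y))))"
      by (intro AE_I2 order_trans[OF bound]) simp
  qed measurable
  show "integrable lebesgue (\<lambda>y. complex_of_real (ln (norm (x - y))) * (vc y * f y))" by (rule log)
  have "(LINT y|lebesgue. cmod (complex_of_real (ln (norm (x - y))) * (vc y * f y))) \<le> A * (1 + norm x)" for x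
  proof -
    have "(LINT y|lebesgue. cmod (complex_of_real (ln (norm (x - y))) * (vc y * f y)))
        \<le> (LINT y|lebesgue. (1 + norm x) * ((1 + norm y) * inv_dist1 x y * (v y * cmod (f y))))"
      using log int by (intro integral_mono bound integrable_norm) auto
    also have "\<dots> \<le> (1 + norm x) * A" using le[of x] by (simp add: mult_left_mono)
    finally show ?thesis by (simp add: mult.commute)
  qed
  then show "\<exists>A\<ge>0. \<forall>x. (LINT y|lebesgue. cmod (complex_of_real (ln (norm (x - y))) * (vc y * f y))) \<le> A * (1 + norm x)"
    using A by blast
qed

lemma G1v_growth:
  assumes f: "f \<in> L2" shows "\<exists>A\<ge>0. \<forall>x. cmod (G1v f x) \<le> A * (1 + norm x)"
proof -
  obtain A where A: "A \<ge> 0" "\<And>x. (LINT y|lebesgue. cmod (complex_of_real (ln (norm (x - y))) * (vc y * f y)))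
      \<le> A * (1 + norm x)" using log_integral_growth[OF f] by blast
  define k where "k = cmod (1 / (8 * of_real pi ^ 2))"
  have "cmod (G1v f x) \<le> k * (A * (1 + norm x))" for x
  proof -
    have "cmod (G1v f x) = k * cmod (LINT y|lebesgue. complex_of_real (ln (norm (x - y))) * (vc y * f y))"
      by (simp only: G1_def norm_mult norm_minus_cancel k_def)
    also have "\<dots> \<le> k * (A * (1 + norm x))"
      by (intro mult_left_mono order_trans[OF integral_norm_bound A(2)]) (simp add: k_def)
    finally show ?thesis .
  qed
  then show ?thesis using A(1) by (intro exI[of _ "k * A"]) (simp add: k_def mult.assoc)
qed

lemma G1v_measurable: "f \<in> borel_measurable lebesgue \<Longrightarrow> G1v f \<in> borel_measurable lebesgue"
  by (rule G1_measurable) simp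

lemma vG1v_L2: assumes f: "f \<in> L2" shows "(\<lambda>x. vc x * G1v f x) \<in> L2"
proof -
  obtain A where A: "A \<ge> 0" "\<And>x. cmod (G1v f x) \<le> A * (1 + norm x)"
    using G1v_growth[OF f] by blast
  have [measurable]: "G1v f \<in> borel_measurable lebesgue" using f by (intro G1v_measurable L2_measurable)
  show ?thesis
  proof (rule L2_bound)
    show "integrable lebesgue (\<lambda>x. A\<^sup>2 * (C\<^sup>2 * weight (2 * \<epsilon>) x))"
      using eps by (simp add: weight_integrable)
    have "(cmod (vc x * G1v f x))\<^sup>2 \<le> A\<^sup>2 * (C\<^sup>2 * weight (2 * \<epsilon>) x)" for x
    proof -
      have "cmod (vc x * G1v f x) \<le> v x * (A * (1 + norm x))"
        using A v_nonneg[of x] by (simp add: norm_mult mult_left_mono)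
      then have "(cmod (vc x * G1v f x))\<^sup>2 \<le> (A * ((1 + norm x) * v x))\<^sup>2"
        by (intro power_mono) (simp_all add: mult_ac)
      also have "\<dots> \<le> A\<^sup>2 * (C\<^sup>2 * weight (2 * \<epsilon>) x)"
        unfolding power_mult_distrib[of A] by (intro mult_left_mono v_weight) simp
      finally show ?thesis .
    qed
    then show "AE x in lebesgue. (cmod (vc x * G1v f x))\<^sup>2 \<le> A\<^sup>2 * (C\<^sup>2 * weight (2 * \<epsilon>) x)" by simp
  qed measurable
qed

lemma U_L2: assumes f: "f \<in> L2" shows "(\<lambda>x. of_real (sgnV V x) * f x) \<in> L2"
proof (rule L2_bound[OF _ L2_integrable[OF f]])
  show "(\<lambda>x. of_real (sgnV V x) * f x) \<in> borel_measurable lebesgue"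
    using L2_measurable[OF f] by measurable
  show "AE x in lebesgue. (cmod (of_real (sgnV V x) * f x))\<^sup>2 \<le> (cmod (f x))\<^sup>2"
    by (simp add: norm_mult sgnV_def)
qed

lemma opT_L2: "f \<in> L2 \<Longrightarrow> T f \<in> L2"
  unfolding opT_def[abs_def] by (intro L2_add U_L2 vG1v_L2)

lemma G1v_cong: assumes "f \<in> L2" "g \<in> L2" "eq_ae f g" shows "G1v f = G1v g"
proof
  fix x
  have "(LINT y|lebesgue. complex_of_real (ln (norm (x - y))) * (vc y * f y))
      = (LINT y|lebesgue. complex_of_real (ln (norm (x - y))) * (vc y * g y))"
    using assms log_integrable by (intro integral_cong_AE borel_measurable_integrable) (auto simp: eq_ae_def)
  then show "G1v f x = G1v g x" by (simp add: G1_def)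
qed

lemma opT_cong: assumes "f \<in> L2" "g \<in> L2" "eq_ae f g" shows "eq_ae (T f) (T g)"
  using assms(3) unfolding eq_ae_def opT_def G1v_cong[OF assms] by eventually_elim simp

lemma opT_scale: "T (\<lambda>x. c * f x) = (\<lambda>x. c * T f x)"
  using G1_scale[of c] by (simp add: opT_def fun_eq_iff algebra_simps)

lemma opT_zero: assumes "f \<in> L2" "eq_ae f (\<lambda>x. 0)" shows "eq_ae (T f) (\<lambda>x. 0)"
  using opT_cong[OF assms(1) L2_zero assms(2)] opT_scale[of 0 "\<lambda>x. 0"] by simp

text \<open>
The kernel \<open>v(x) log |x - y| v(y)\<close> is real and symmetric; the content is the integrability that
permits exchanging the integrals. The inner absolute integral grows at most like \<open>1 + |x|\<close>, which
the factor \<open>v(x)\<close> compensates.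
\<close>

theorem opT_symmetric:
  assumes f: "f \<in> L2" and g: "g \<in> L2"
  shows "L2_inner (T f) g = L2_inner f (T g)"
proof -
  interpret pair_sigma_finite "lebesgue :: (real^4) measure" "lebesgue :: (real^4) measure"
    by (intro pair_sigma_finite.intro sigma_finite_lebesgue)
  have [measurable]: "f \<in> borel_measurable lebesgue" "g \<in> borel_measurable lebesgue"
    using f g L2_measurable by blast+
  define k :: complex where "k = - (1 / (8 * of_real pi ^ 2))"
  have cnj_k: "cnj k = k" by (simp add: k_def)
  define L where "L x y = complex_of_real (ln (norm (x - y)))" for x y :: "real^4"
  define H where "H x y = k * (vc x * cnj (g x)) * (L x y * (vc y * f y))" for x y
  have cg: "(\<lambda>x. cnj (g x)) \<in> borel_measurable lebesgue" by (rule L2_measurable[OF L2_cnj[OF g]])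
  have H_meas: "(\<lambda>p. H (fst p) (snd p)) \<in> borel_measurable (lebesgue \<Otimes>\<^sub>M lebesgue)"
  proof -
    note [measurable] = cg
    show ?thesis unfolding H_def L_def by measurable
  qed
  obtain A where A: "A \<ge> 0" "\<And>x. (LINT y|lebesgue. cmod (L x y * (vc y * f y))) \<le> A * (1 + norm x)"
    using log_integral_growth[OF f] unfolding L_def by blast
  have row: "(LINT y|lebesgue. norm (H x y)) = cmod k * (v x * cmod (g x)) * (LINT y|lebesgue. cmod (L x y * (vc y * f y)))" for x
    using v_nonneg[of x] by (simp add: H_def norm_mult)
  have H_int: "integrable (lebesgue \<Otimes>\<^sub>M lebesgue) (\<lambda>p. H (fst p) (snd p))"
  proof (rule Fubini_integrable[OF H_meas])
    show "integrable lebesgue (\<lambda>x. LINT y|lebesgue. norm (H (fst (x, y)) (snd (x, y))))"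
    proof (rule Bochner_Integration.integrable_bound)
      show "integrable lebesgue (\<lambda>x. (cmod k * A) * cmod (complex_of_real ((1 + norm x) * v x) * g x))"
        using L2_prod_integrable[OF weighted_v_L2 g] by (intro integrable_mult_right integrable_norm)
      show "(\<lambda>x. LINT y|lebesgue. norm (H (fst (x, y)) (snd (x, y)))) \<in> borel_measurable lebesgue"
        by (rule sigma_finite_measure.borel_measurable_lebesgue_integral[OF sigma_finite_lebesgue])
           (use H_meas in \<open>simp add: split_beta'\<close>)
      show "AE x in lebesgue. norm (LINT y|lebesgue. norm (H (fst (x, y)) (snd (x, y))))
          \<le> norm ((cmod k * A) * cmod (complex_of_real ((1 + norm x) * v x) * g x))"
      proof (rule AE_I2)
        fix x
        have "norm (LINT y|lebesgue. norm (H x y)) = (LINT y|lebesgue. norm (H x y))" by simp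
        also have "\<dots> \<le> cmod k * (v x * cmod (g x)) * (A * (1 + norm x))"
          unfolding row using v_nonneg[of x] by (intro mult_left_mono A) auto
        also have "\<dots> = (cmod k * A) * cmod (complex_of_real ((1 + norm x) * v x) * g x)"
        proof -
          have "cmod (complex_of_real ((1 + norm x) * v x)) = (1 + norm x) * v x"
            using v_nonneg[of x] by (simp only: norm_of_real) simp
          then have "cmod (complex_of_real ((1 + norm x) * v x) * g x) = (1 + norm x) * v x * cmod (g x)"
            by (simp only: norm_mult[of _ "g x"])
          then show ?thesis by (simp only: mult_ac)
        qed
        also have "\<dots> \<le> norm \<dots>" by simp
        finally show "norm (LINT y|lebesgue. norm (H (fst (x, y)) (snd (x, y))))
          \<le> norm ((cmod k * A) * cmod (complex_of_real ((1 + norm x) * v x) * g x))" by simp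
      qed
    qed
    show "AE x in lebesgue. integrable lebesgue (\<lambda>y. H (fst (x, y)) (snd (x, y)))"
      using log_integrable[OF f] by (simp add: H_def L_def)
  qed
  have "(LINT x|lebesgue. vc x * G1v f x * cnj (g x)) = (LINT x|lebesgue. LINT y|lebesgue. H x y)"
  proof (rule Bochner_Integration.integral_cong[OF refl])
    fix x
    define I where "I = (LINT y|lebesgue. L x y * (vc y * f y))"
    have "(LINT y|lebesgue. H x y) = k * (vc x * cnj (g x)) * I" by (simp add: H_def I_def)
    moreover have "G1v f x = k * I" by (simp add: G1_def k_def L_def I_def)
    ultimately show "vc x * G1v f x * cnj (g x) = (LINT y|lebesgue. H x y)" by (simp add: mult_ac)
  qed
  also have "\<dots> = (LINT y|lebesgue. LINT x|lebesgue. H x y)"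
    using H_int by (intro Fubini_integral[symmetric]) (simp add: split_beta')
  also have "\<dots> = (LINT y|lebesgue. f y * cnj (vc y * G1v g y))"
  proof (rule Bochner_Integration.integral_cong[OF refl])
    fix y
    have "cnj (G1v g y) = k * (LINT x|lebesgue. L x y * (vc x * cnj (g x)))"
    proof -
      have "cnj (G1v g y) = cnj k * cnj (LINT x|lebesgue. L y x * (vc x * g x))"
        by (simp add: G1_def k_def L_def)
      also have "cnj (LINT x|lebesgue. L y x * (vc x * g x)) = (LINT x|lebesgue. cnj (L y x * (vc x * g x)))"
        by (rule Bochner_Integration.integral_cnj[symmetric])
      finally show ?thesis by (simp add: cnj_k L_def norm_minus_commute)
    qed
    moreover have "(LINT x|lebesgue. H x y)
        = k * (vc y * f y) * (LINT x|lebesgue. L x y * (vc x * cnj (g x)))"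
      unfolding integral_mult_right_zero[symmetric] by (simp only: H_def mult_ac)
    ultimately show "(LINT x|lebesgue. H x y) = f y * cnj (vc y * G1v g y)"
      by (simp add: mult_ac)
  qed
  finally have G: "L2_inner (\<lambda>x. vc x * G1v f x) g = L2_inner f (\<lambda>x. vc x * G1v g x)"
    by (simp add: L2_inner_def)
  have U: "L2_inner (\<lambda>x. of_real (sgnV V x) * f x) g = L2_inner f (\<lambda>x. of_real (sgnV V x) * g x)"
    by (simp add: L2_inner_def mult_ac)
  have "L2_inner (T f) g = L2_inner (\<lambda>x. of_real (sgnV V x) * f x) g + L2_inner (\<lambda>x. vc x * G1v f x) g"
    unfolding opT_def[abs_def] by (rule L2_inner_add_left[OF U_L2[OF f] vG1v_L2[OF f] g])
  also have "\<dots> = cnj (L2_inner (\<lambda>x. of_real (sgnV V x) * g x) f + L2_inner (\<lambda>x. vc x * G1v g x) f)"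
    unfolding G U by (simp add: L2_inner_cnj[of f])
  also have "\<dots> = cnj (L2_inner (T g) f)"
    unfolding opT_def[abs_def] by (subst L2_inner_add_left[OF U_L2[OF g] vG1v_L2[OF g] f]) simp
  finally show ?thesis by (simp add: L2_inner_cnj[of f])
qed

end

section \<open>The kernels that define the projections\<close>

context decaying_potential
begin

lemma L2_sq_v: "L2_sq vc = norm_L1 V"
  by (simp add: L2_sq_def norm_L1_def rootV_def)

lemma L2_sq_v_pos: "L2_sq vc > 0"
proof (rule ccontr)
  assume "\<not> ?thesis"
  then have "L2_sq vc = 0" using L2_sq_nonneg[of vc] by simp
  then have "eq_ae vc (\<lambda>x. 0)" by (rule L2_sq_eq_0[OF v_L2])
  then show False using V_nonzero by (simp add: eq_ae_def rootV_def)
qed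

text \<open>
The coefficient of the orthogonal projection onto the span of \<open>v\<close>; the constant \<open>c\<^sub>0\<close> of the
theorem is \<open>coef (T \<phi>)\<close>.
\<close>

definition coef :: "fn4 \<Rightarrow> complex" where
  "coef f = L2_inner f vc / of_real (L2_sq vc)"

lemma coef_eq_0_iff: "coef f = 0 \<longleftrightarrow> L2_inner f vc = 0"
  using L2_sq_v_pos by (simp add: coef_def)

lemma coef_cong: "f \<in> L2 \<Longrightarrow> g \<in> L2 \<Longrightarrow> eq_ae f g \<Longrightarrow> coef f = coef g"
  unfolding coef_def by (subst L2_inner_cong[of f g vc vc]) (simp_all add: v_L2)

lemma residual_orth:
  assumes "f \<in> L2" shows "L2_inner (\<lambda>x. f x - coef f * vc x) vc = 0"
proof -
  have "L2_inner (\<lambda>x. f x - coef f * vc x) vc = L2_inner f vc - coef f * L2_inner vc vc"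
    by (simp only: L2_inner_diff_left[OF assms L2_scale[OF v_L2] v_L2] L2_inner_scale_left)
  then show ?thesis using L2_sq_v_pos by (simp add: L2_inner_self coef_def)
qed

lemma span_v_L2: "span_v V \<subseteq> L2" by (auto simp: span_v_def)

lemma span_v_diff:
  assumes "a \<in> span_v V" "b \<in> span_v V" shows "(\<lambda>x. a x - b x) \<in> span_v V"
proof -
  obtain c d where c: "eq_ae a (\<lambda>x. c * vc x)" and d: "eq_ae b (\<lambda>x. d * vc x)"
    using assms by (auto simp: span_v_def)
  have "eq_ae (\<lambda>x. a x - b x) (\<lambda>x. (c - d) * vc x)"
    using c d unfolding eq_ae_def by eventually_elim (simp add: left_diff_distrib)
  moreover have "a \<in> L2" "b \<in> L2" using assms span_v_L2 by blast+
  ultimately show ?thesis unfolding span_v_def using L2_diff by blast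
qed

lemma
  assumes f: "f \<in> L2"
  shows opP_L2: "opP V f \<in> L2" and opP_eq: "eq_ae (opP V f) (\<lambda>x. coef f * vc x)"
proof -
  have g: "(\<lambda>x. coef f * vc x) \<in> span_v V"
    unfolding span_v_def using L2_scale[OF v_L2] eq_ae_refl by blast
  have orth: "L2_inner (\<lambda>x. f x - coef f * vc x) h = 0" if h: "h \<in> span_v V" for h
  proof -
    obtain c where c: "eq_ae h (\<lambda>x. c * vc x)" "h \<in> L2" using h by (auto simp: span_v_def)
    have "L2_inner (\<lambda>x. f x - coef f * vc x) h = L2_inner (\<lambda>x. f x - coef f * vc x) (\<lambda>x. c * vc x)"
      by (rule L2_inner_cong) (simp_all add: c f v_L2 L2_diff L2_scale)
    then show ?thesis by (simp add: L2_inner_scale_right residual_orth[OF f])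
  qed
  show "opP V f \<in> L2" unfolding opP_def
    using orth_proj_unique(1)[OF span_v_L2 span_v_diff f g orth] span_v_L2 by blast
  show "eq_ae (opP V f) (\<lambda>x. coef f * vc x)" unfolding opP_def
    using orth_proj_unique(3)[OF span_v_L2 span_v_diff f g orth] by blast
qed

lemma opQ_L2: "f \<in> L2 \<Longrightarrow> opQ V f \<in> L2"
  unfolding opQ_def[abs_def] by (intro L2_diff opP_L2)

lemma opQ_eq: "f \<in> L2 \<Longrightarrow> eq_ae (opQ V f) (\<lambda>x. f x - coef f * vc x)"
  using opP_eq[of f] unfolding eq_ae_def opQ_def by auto

lemma orth_compl_v_iff: "f \<in> orth_compl {vc} \<longleftrightarrow> f \<in> L2 \<and> L2_inner f vc = 0"
  by (simp add: orth_compl_def)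

lemma opQ_fix: "f \<in> orth_compl {vc} \<Longrightarrow> eq_ae (opQ V f) f"
  using opQ_eq[of f] coef_eq_0_iff[of f] by (simp add: orth_compl_v_iff)

lemma residual_orth_compl: "f \<in> L2 \<Longrightarrow> (\<lambda>x. f x - coef f * vc x) \<in> orth_compl {vc}"
  by (simp add: orth_compl_v_iff residual_orth L2_diff L2_scale v_L2)

lemma range_opQ: "range_L2 (opQ V) = orth_compl {vc}"
proof (intro equalityI subsetI)
  fix f assume "f \<in> range_L2 (opQ V)"
  then obtain g where g: "f \<in> L2" "g \<in> L2" "eq_ae f (opQ V g)" by (auto simp: range_L2_def)
  show "f \<in> orth_compl {vc}"
  proof (rule orth_compl_cong[OF _ residual_orth_compl[OF g(2)] g(1)])
    show "eq_ae (\<lambda>x. g x - coef g * vc x) f"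
      by (rule eq_ae_sym[OF eq_ae_trans[OF g(3) opQ_eq[OF g(2)]]])
  qed (simp add: v_L2)
next
  fix f assume f: "f \<in> orth_compl {vc}"
  then show "f \<in> range_L2 (opQ V)"
    using opQ_fix[OF f] eq_ae_sym orth_compl_v_iff unfolding range_L2_def by blast
qed

text \<open>
The ranges of \<open>S\<^sub>1\<close> and \<open>S\<^sub>2\<close> turn out to be the orthogonal complements of these sets. Describing
them by test functions makes their closedness automatic.
\<close>

definition S1_tests :: "fn4 set" where "S1_tests = insert vc (T ` orth_compl {vc})"
definition S2_tests :: "fn4 set" where "S2_tests = insert (T vc) S1_tests"

lemma S1_tests_L2: "S1_tests \<subseteq> L2" and S2_tests_L2: "S2_tests \<subseteq> L2"
  using v_L2 opT_L2 orth_compl_L2 by (auto simp: S1_tests_def S2_tests_def)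

text \<open>
By symmetry, being orthogonal to \<open>T h\<close> for all \<open>h \<bottom> v\<close> says that \<open>T f\<close> is orthogonal to
everything orthogonal to \<open>v\<close>. Testing with the residual of \<open>T f\<close> itself shows that \<open>T f\<close> is a
multiple of \<open>v\<close>.
\<close>

lemma orth_compl_S1_tests_iff:
  "f \<in> orth_compl S1_tests \<longleftrightarrow> f \<in> orth_compl {vc} \<and> eq_ae (T f) (\<lambda>x. coef (T f) * vc x)"
proof (cases "f \<in> orth_compl {vc}")
  case f: True
  then have fL: "f \<in> L2" by (simp add: orth_compl_v_iff)
  then have TL: "T f \<in> L2" by (rule opT_L2)
  have "f \<in> orth_compl S1_tests \<longleftrightarrow> (\<forall>h\<in>orth_compl {vc}. L2_inner (T f) h = 0)"
  proof -
    have "f \<in> orth_compl S1_tests \<longleftrightarrow> (\<forall>h\<in>orth_compl {vc}. L2_inner f (T h) = 0)"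
      using f by (simp add: orth_compl_def S1_tests_def)
    then show ?thesis using opT_symmetric[OF fL] by (simp add: orth_compl_v_iff)
  qed
  also have "\<dots> \<longleftrightarrow> eq_ae (T f) (\<lambda>x. coef (T f) * vc x)"
  proof
    assume orth: "\<forall>h\<in>orth_compl {vc}. L2_inner (T f) h = 0"
    define h where "h x = T f x - coef (T f) * vc x" for x
    have h: "h \<in> orth_compl {vc}" unfolding h_def by (rule residual_orth_compl[OF TL])
    then have hL: "h \<in> L2" and hv: "L2_inner h vc = 0" by (simp_all add: orth_compl_v_iff)
    have "L2_inner h h = L2_inner (T f) h - coef (T f) * L2_inner vc h"
      using TL hL v_L2 unfolding h_def[abs_def]
      by (subst L2_inner_diff_left) (simp_all add: L2_scale L2_inner_scale_left)
    also have "\<dots> = 0" using orth h hv L2_inner_cnj[of vc h] by simp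
    finally have "eq_ae h (\<lambda>x. 0)" using L2_sq_eq_0[OF hL] by (simp add: L2_inner_self)
    then show "eq_ae (T f) (\<lambda>x. coef (T f) * vc x)" by (simp add: eq_ae_def h_def)
  next
    assume eq: "eq_ae (T f) (\<lambda>x. coef (T f) * vc x)"
    show "\<forall>h\<in>orth_compl {vc}. L2_inner (T f) h = 0"
    proof
      fix h assume h: "h \<in> orth_compl {vc}"
      then have hL: "h \<in> L2" and hv: "L2_inner h vc = 0" by (simp_all add: orth_compl_v_iff)
      have "L2_inner (T f) h = L2_inner (\<lambda>x. coef (T f) * vc x) h"
        by (rule L2_inner_cong[OF eq eq_ae_refl TL L2_scale[OF v_L2] hL hL])
      then show "L2_inner (T f) h = 0"
        using hv L2_inner_cnj[of vc h] by (simp add: L2_inner_scale_left)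
    qed
  qed
  finally show ?thesis using f by simp
next
  case False
  then show ?thesis by (auto simp: orth_compl_def S1_tests_def)
qed

lemma kernel_QTQ: "kernel_on (range_L2 (opQ V)) (opQ V \<circ> T \<circ> opQ V) = orth_compl S1_tests"
proof -
  have "eq_ae ((opQ V \<circ> T \<circ> opQ V) f) (\<lambda>x. 0) \<longleftrightarrow> eq_ae (T f) (\<lambda>x. coef (T f) * vc x)"
    if f: "f \<in> orth_compl {vc}" for f
  proof -
    have fL: "f \<in> L2" using f by (simp add: orth_compl_v_iff)
    have QL: "opQ V f \<in> L2" by (rule opQ_L2[OF fL])
    have eq: "eq_ae (T (opQ V f)) (T f)" by (rule opT_cong[OF QL fL opQ_fix[OF f]])
    have "coef (T (opQ V f)) = coef (T f)"
      by (rule coef_cong[OF opT_L2[OF QL] opT_L2[OF fL] eq])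
    then have "eq_ae (opQ V (T (opQ V f))) (\<lambda>x. T (opQ V f) x - coef (T f) * vc x)"
      using opQ_eq[OF opT_L2[OF QL]] by simp
    then have "AE x in lebesgue. opQ V (T (opQ V f)) x = T f x - coef (T f) * vc x"
      using eq unfolding eq_ae_def by eventually_elim simp
    then have "AE x in lebesgue. opQ V (T (opQ V f)) x = 0 \<longleftrightarrow> T f x = coef (T f) * vc x"
      by eventually_elim simp
    then show ?thesis by (auto simp: eq_ae_def elim: AE_mp)
  qed
  then show ?thesis unfolding kernel_on_def range_opQ by (auto simp: orth_compl_S1_tests_iff)
qed

lemma S1_eq: "S1 V = orth_proj (orth_compl S1_tests)"
  by (simp add: S1_def kernel_QTQ)

lemma range_S1: "range_L2 (S1 V) = orth_compl S1_tests"
  unfolding S1_eq by (rule range_orth_proj_orth_compl[OF S1_tests_L2])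

lemma orth_compl_S2_tests_iff: "f \<in> orth_compl S2_tests \<longleftrightarrow> f \<in> orth_compl S1_tests \<and> L2_inner (T f) vc = 0"
  using opT_symmetric[OF _ v_L2, of f] by (auto simp: orth_compl_def S2_tests_def)

text \<open>
If \<open>S\<^sub>1 T P T f = 0\<close>, pairing with \<open>f\<close> and moving \<open>S\<^sub>1\<close> and \<open>T\<close> to the other side gives
\<open>0 = \<langle>P T f, T f\<rangle>\<close>, a positive multiple of \<open>|\<langle>T f, v\<rangle>|\<^sup>2\<close>. Functions are changed on null
sets throughout, which is why each operator needs its compatibility with \<open>eq_ae\<close>.
\<close>

lemma kernel_STPTS:
  "kernel_on (range_L2 (S1 V)) (S1 V \<circ> T \<circ> opP V \<circ> T \<circ> S1 V) = orth_compl S2_tests"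
proof -
  have "eq_ae ((S1 V \<circ> T \<circ> opP V \<circ> T \<circ> S1 V) f) (\<lambda>x. 0) \<longleftrightarrow> L2_inner (T f) vc = 0"
    if f: "f \<in> orth_compl S1_tests" for f
  proof -
    have fL: "f \<in> L2" using f orth_compl_L2 by blast
    define s where "s = S1 V f"
    have sL: "s \<in> L2"
      unfolding s_def S1_eq using orth_proj_orth_compl_mem[OF S1_tests_L2 fL] orth_compl_L2 by blast
    have sf: "eq_ae s f" unfolding s_def S1_eq by (rule orth_proj_orth_compl_fix[OF S1_tests_L2 fL f eq_ae_refl])
    define p where "p = opP V (T s)"
    have pL: "p \<in> L2" unfolding p_def by (rule opP_L2[OF opT_L2[OF sL]])
    have "coef (T s) = coef (T f)"
      by (rule coef_cong[OF opT_L2[OF sL] opT_L2[OF fL] opT_cong[OF sL fL sf]])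
    then have p_eq: "eq_ae p (\<lambda>x. coef (T f) * vc x)"
      using opP_eq[OF opT_L2[OF sL]] by (simp add: p_def)
    define q where "q = T p"
    have qL: "q \<in> L2" unfolding q_def by (rule opT_L2[OF pL])
    have SqL: "S1 V q \<in> L2"
      unfolding S1_eq using orth_proj_orth_compl_mem[OF S1_tests_L2 qL] orth_compl_L2 by blast
    have "eq_ae (S1 V q) (\<lambda>x. 0) \<longleftrightarrow> L2_inner (T f) vc = 0"
    proof
      assume zero: "eq_ae (S1 V q) (\<lambda>x. 0)"
      have "L2_inner (S1 V q) f = 0"
        using L2_inner_cong[OF zero eq_ae_refl SqL L2_zero fL fL] by simp
      moreover have "L2_inner q f - L2_inner (S1 V q) f = 0"
        using orth_proj_orth_compl_orth[OF S1_tests_L2 qL f] L2_inner_diff_left[OF qL SqL fL] by (simp add: S1_eq)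
      ultimately have "0 = L2_inner (T p) f" by (simp add: q_def)
      also have "\<dots> = L2_inner p (T f)" by (rule opT_symmetric[OF pL fL])
      also have "\<dots> = L2_inner (\<lambda>x. coef (T f) * vc x) (T f)"
        by (rule L2_inner_cong[OF p_eq eq_ae_refl pL L2_scale[OF v_L2] opT_L2[OF fL] opT_L2[OF fL]])
      also have "\<dots> = coef (T f) * cnj (L2_inner (T f) vc)"
        by (simp only: L2_inner_scale_left L2_inner_cnj[of vc "T f"])
      finally show "L2_inner (T f) vc = 0" using coef_eq_0_iff by auto
    next
      assume "L2_inner (T f) vc = 0"
      then have "eq_ae p (\<lambda>x. 0)" using p_eq coef_eq_0_iff[of "T f"] by simp
      then have "eq_ae q (\<lambda>x. 0)" unfolding q_def by (rule opT_zero[OF pL])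
      moreover have "(\<lambda>x. 0) \<in> orth_compl S1_tests" by (simp add: orth_compl_def L2_zero)
      ultimately show "eq_ae (S1 V q) (\<lambda>x. 0)"
        unfolding S1_eq by (intro orth_proj_orth_compl_fix[OF S1_tests_L2 qL])
    qed
    then show ?thesis by (simp add: q_def p_def s_def)
  qed
  then show ?thesis unfolding kernel_on_def range_S1 by (auto simp: orth_compl_S2_tests_iff)
qed

lemma range_S2: "range_L2 (S2 V) = orth_compl S2_tests"
  unfolding S2_def kernel_STPTS by (rule range_orth_proj_orth_compl[OF S2_tests_L2])

section \<open>Boundedness and decay of the logarithmic potential\<close>

lemma G1v_mean_zero:
  assumes f: "f \<in> orth_compl {vc}"
  shows "G1v f x = - (1 / (8 * of_real pi ^ 2)) *
     (LINT y|lebesgue. of_real (ln (norm (x - y)) - ln (1 + norm x)) * (vc y * f y))"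
proof -
  have fL: "f \<in> L2" and f0: "L2_inner f vc = 0" using f by (simp_all add: orth_compl_v_iff)
  have vf: "integrable lebesgue (\<lambda>y. vc y * f y)" by (rule L2_prod_integrable[OF v_L2 fL])
  have "(LINT y|lebesgue. vc y * f y) = 0" using f0 by (simp add: L2_inner_def mult.commute)
  then have "(LINT y|lebesgue. of_real (ln (norm (x - y)) - ln (1 + norm x)) * (vc y * f y))
      = (LINT y|lebesgue. complex_of_real (ln (norm (x - y))) * (vc y * f y))"
    using log_integrable[OF fL, of x] vf
    by (simp add: left_diff_distrib)
  then show ?thesis by (simp add: G1_def)
qed

text \<open>
The common step of \<open>G1v_bounded\<close> (with \<open>w = 1\<close>) and \<open>G1v_decay\<close> (with \<open>w = 1 + |x|\<close>). A bound
off the diagonal suffices, since the point \<open>y = x\<close> is a null set.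
\<close>

lemma G1v_bound:
  assumes f: "f \<in> orth_compl {vc}" and w: "0 \<le> w" and g: "integrable lebesgue g"
    and le: "\<And>y. x \<noteq> y \<Longrightarrow> w * \<bar>ln (norm (x - y)) - ln (1 + norm x)\<bar> * (v y * cmod (f y)) \<le> g y"
  shows "w * cmod (G1v f x) \<le> cmod (1 / (8 * of_real pi ^ 2)) * (LINT y|lebesgue. g y)"
proof -
  define k where "k = cmod (1 / (8 * of_real pi ^ 2))"
  define h where "h y = of_real (ln (norm (x - y)) - ln (1 + norm x)) * (vc y * f y)" for y
  have "w * cmod (G1v f x) = k * cmod (of_real w * (LINT y|lebesgue. h y))"
    unfolding G1v_mean_zero[OF f] k_def h_def using w
    by (simp only: norm_mult norm_minus_cancel norm_of_real abs_of_nonneg mult.left_commute)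
  also have "of_real w * (LINT y|lebesgue. h y) = (LINT y|lebesgue. of_real w * h y)" by simp
  also have "k * cmod (LINT y|lebesgue. of_real w * h y) \<le> k * (LINT y|lebesgue. g y)"
  proof (rule mult_left_mono)
    have "cmod (LINT y|lebesgue. of_real w * h y) \<le> (LINT y|lebesgue. cmod (of_real w * h y))"
      by (rule integral_norm_bound)
    also have "\<dots> \<le> (LINT y|lebesgue. g y)"
    proof -
      have "AE y in lebesgue. y \<noteq> x" by (rule AE_I'[of "{x}"]) auto
      then have ae: "AE y in lebesgue. cmod (of_real w * h y) \<le> g y"
      proof eventually_elim
        case (elim y)
        have "cmod (of_real w * h y) = w * \<bar>ln (norm (x - y)) - ln (1 + norm x)\<bar> * (v y * cmod (f y))"
          unfolding h_def norm_mult norm_of_real using w v_nonneg[of y] by simp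
        then show ?case using le[of y] elim by auto
      qed
      then have "AE y in lebesgue. 0 \<le> g y"
        by eventually_elim (rule order_trans[OF norm_ge_zero])
      then show ?thesis by (intro integral_mono_AE'[OF g ae])
    qed
    finally show "cmod (LINT y|lebesgue. of_real w * h y) \<le> (LINT y|lebesgue. g y)" .
  qed (simp add: k_def)
  finally show ?thesis by (simp only: k_def)
qed

lemma G1v_bounded:
  assumes f: "f \<in> orth_compl {vc}" shows "\<exists>B. \<forall>x. cmod (G1v f x) \<le> B"
proof -
  have fL: "f \<in> L2" using f by (simp add: orth_compl_v_iff)
  obtain A where A: "A \<ge> 0"
    and int: "\<And>x. integrable lebesgue (\<lambda>y. (1 + norm y) * inv_dist1 x y * (v y * cmod (f y)))"
    and le: "\<And>x. (LINT y|lebesgue. (1 + norm y) * inv_dist1 x y * (v y * cmod (f y))) \<le> A"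
    using kernel_integrable[OF fL] by blast
  define k where "k = cmod (1 / (8 * of_real pi ^ 2))"
  have "cmod (G1v f x) \<le> k * A" for x
  proof -
    have "1 * cmod (G1v f x) \<le> k * (LINT y|lebesgue. (1 + norm y) * inv_dist1 x y * (v y * cmod (f y)))"
      unfolding k_def
    proof (rule G1v_bound[OF f _ int])
      show "1 * \<bar>ln (norm (x - y)) - ln (1 + norm x)\<bar> * (v y * cmod (f y))
          \<le> (1 + norm y) * inv_dist1 x y * (v y * cmod (f y))" if "x \<noteq> y" for y
        using ln_dist_diff_le[OF that] v_nonneg[of y] by (simp add: mult_right_mono)
    qed simp
    also have "\<dots> \<le> k * A" by (intro mult_left_mono le) (simp add: k_def)
    finally show ?thesis by simp
  qed
  then show ?thesis by blast
qed

text \<open>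
With \<open>|f| \<le> B v\<close> the integrand is of order \<open>v\<^sup>2\<close>, which leaves room for the factor \<open>(1 + |y|)\<^sup>2\<close> of
\<open>ln_dist_diff_decay\<close>.
\<close>

lemma G1v_decay:
  assumes f: "f \<in> orth_compl {vc}" and B: "\<And>y. cmod (f y) \<le> B * v y"
  shows "\<exists>D. \<forall>x. cmod (G1v f x) \<le> D * (1 + norm x) powr (- 1)"
proof -
  obtain K where K: "\<And>x. integrable lebesgue (\<lambda>y. weight (2*\<epsilon>) y * (inv_dist1 x y)\<^sup>2)"
      "\<And>x. (LINT y|lebesgue. weight (2*\<epsilon>) y * (inv_dist1 x y)\<^sup>2) \<le> K"
    using weight_inv_dist_integrable[of "2 * \<epsilon>"] eps by auto
  define k where "k = cmod (1 / (8 * of_real pi ^ 2))"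
  \<comment> \<open>Enlarging \<open>B\<close> avoids looking for a point where \<open>v\<close> is positive.\<close>
  define B' where "B' = max B 0"
  have B': "cmod (f y) \<le> B' * v y" "0 \<le> B'" for y
    using order_trans[OF B[of y] mult_right_mono[of B "max B 0" "v y"]] v_nonneg[of y]
    by (auto simp: B'_def)
  have "(1 + norm x) * cmod (G1v f x) \<le> k * (B' * C\<^sup>2 * K)" for x
  proof -
    have "(1 + norm x) * cmod (G1v f x)
        \<le> k * (LINT y|lebesgue. B' * C\<^sup>2 * (weight (2*\<epsilon>) y * (inv_dist1 x y)\<^sup>2))"
      unfolding k_def
    proof (rule G1v_bound[OF f])
      show "integrable lebesgue (\<lambda>y. B' * C\<^sup>2 * (weight (2*\<epsilon>) y * (inv_dist1 x y)\<^sup>2))"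
        using K(1) by simp
      fix y assume xy: "x \<noteq> y"
      have "(1 + norm x) * \<bar>ln (norm (x - y)) - ln (1 + norm x)\<bar> * (v y * cmod (f y))
          \<le> ((1 + norm y)\<^sup>2 * inv_dist1 x y) * (v y * (B' * v y))"
        by (intro mult_mono ln_dist_diff_decay[OF xy] B')
           (use v_nonneg[of y] inv_dist1_ge_1[of x y] B' in \<open>auto intro!: mult_nonneg_nonneg\<close>)
      also have "\<dots> = B' * (((1 + norm y) * v y)\<^sup>2 * inv_dist1 x y)"
        by (simp add: power2_eq_square mult_ac)
      also have "\<dots> \<le> B' * ((C\<^sup>2 * weight (2*\<epsilon>) y) * (inv_dist1 x y)\<^sup>2)"
        using inv_dist1_ge_1[of x y] weight_nonneg[of "2*\<epsilon>" y]
        by (intro mult_left_mono mult_mono v_weight B' self_le_power) auto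
      finally show "(1 + norm x) * \<bar>ln (norm (x - y)) - ln (1 + norm x)\<bar> * (v y * cmod (f y))
          \<le> B' * C\<^sup>2 * (weight (2*\<epsilon>) y * (inv_dist1 x y)\<^sup>2)" by (simp add: mult.assoc)
    qed simp
    also have "\<dots> \<le> k * (B' * C\<^sup>2 * K)"
      using K(2)[of x] B'(2) by (simp add: k_def mult_left_mono del: times_divide_eq_left)
    finally show ?thesis .
  qed
  then have "cmod (G1v f x) \<le> k * (B' * C\<^sup>2 * K) * (1 + norm x) powr (- 1)" for x
    by (simp add: powr_minus field_simps add_pos_nonneg)
  then show ?thesis by blast
qed

end

section \<open>Membership in the Lebesgue spaces\<close>

lemma const_integrable_lebesgue:
  assumes "integrable (lebesgue :: (real^4) measure) (\<lambda>_. c :: real)" shows "c = 0"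
proof (rule ccontr)
  assume c: "c \<noteq> 0"
  have "(\<integral>\<^sup>+(x::real^4). ennreal (norm c) \<partial>lebesgue) < \<infinity>"
    using assms by (simp add: integrable_iff_bounded)
  then show False using c by (simp add: ennreal_mult_top)
qed

lemma Lspace_decay_1:
  assumes f: "f \<in> borel_measurable lebesgue"
    and D: "\<And>x. cmod (f x) \<le> D * (1 + norm x) powr (- 1)" and p: "4 < p"
  shows "f \<in> Lspace p"
proof (cases "p = \<infinity>")
  case True
  have "D \<ge> 0" using order_trans[OF norm_ge_zero D[of 0]] by simp
  then have "cmod (f x) \<le> D" for x
    using D[of x] powr_mono[of "-1" 0 "1 + norm x"] mult_left_mono[of "(1 + norm x) powr (- 1)" 1 D]
    by (simp split: if_splits)
  then show ?thesis using f True by (auto simp: Lspace_def)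
next
  case False
  then obtain q where q: "p = ennreal q" "q \<ge> 0" by (cases p) auto
  have q4: "q > 4" using p q by (simp add: ennreal_less_iff flip: ennreal_numeral)
  have D0: "D \<ge> 0" using order_trans[OF norm_ge_zero D[of 0]] by simp
  have "integrable lebesgue (\<lambda>x. cmod (f x) powr q)"
  proof (rule Bochner_Integration.integrable_bound)
    show "integrable lebesgue (\<lambda>x. D powr q * weight (q - 4) x)"
      using q4 by (simp add: weight_integrable)
    show "(\<lambda>x. cmod (f x) powr q) \<in> borel_measurable lebesgue" using f by measurable
    have "cmod (f x) powr q \<le> D powr q * weight (q - 4) x" for x
    proof -
      have "cmod (f x) powr q \<le> (D * (1 + norm x) powr (- 1)) powr q"
        using D q by (intro powr_mono2) auto
      also have "\<dots> = D powr q * weight (q - 4) x"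
        by (simp only: powr_mult powr_powr weight_def) simp
      finally show ?thesis .
    qed
    then show "AE x in lebesgue. norm (cmod (f x) powr q) \<le> norm (D powr q * weight (q - 4) x)"
      by (simp add: weight_nonneg)
  qed
  then show ?thesis using f False q by (simp add: Lspace_def)
qed

lemma sum_powr_5_le:
  assumes "0 \<le> (a::real)" "0 \<le> b" shows "(a + b) powr 5 \<le> 32 * (a powr 5 + b powr 5)"
proof -
  have "a + b \<le> 2 * max a b" by simp
  then have "(a + b) powr 5 \<le> (2 * max a b) powr 5" using assms by (intro powr_mono2) auto
  also have "\<dots> = 32 * max a b powr 5" using assms by (simp add: powr_mult powr_numeral)
  also have "\<dots> \<le> 32 * (a powr 5 + b powr 5)" by (simp add: max_def)
  finally show ?thesis .
qed

lemma const_diff_Lspace_5: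
  assumes "(\<lambda>x. c - f x) \<in> Lspace 5" "f \<in> Lspace 5" shows "c = 0"
proof -
  have five: "enn2real (5::ennreal) = 5" "(5::ennreal) \<noteq> \<infinity>" by simp_all
  have int: "integrable lebesgue (\<lambda>x. cmod (c - f x) powr 5)" "integrable lebesgue (\<lambda>x. cmod (f x) powr 5)"
    using assms five by (simp_all add: Lspace_def)
  have "integrable lebesgue (\<lambda>x::real^4. cmod c powr 5)"
  proof (rule Bochner_Integration.integrable_bound)
    show "integrable lebesgue (\<lambda>x. 32 * (cmod (c - f x) powr 5 + cmod (f x) powr 5))"
      using int by simp
    have "cmod c powr 5 \<le> 32 * (cmod (c - f x) powr 5 + cmod (f x) powr 5)" for x
    proof -
      have "cmod c \<le> cmod (c - f x) + cmod (f x)"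
        using norm_triangle_ineq[of "c - f x" "f x"] by simp
      then have "cmod c powr 5 \<le> (cmod (c - f x) + cmod (f x)) powr 5" by (intro powr_mono2) auto
      also have "\<dots> \<le> 32 * (cmod (c - f x) powr 5 + cmod (f x) powr 5)"
        by (rule sum_powr_5_le) auto
      finally show ?thesis .
    qed
    then show "AE x in lebesgue. norm (cmod c powr 5) \<le> norm (32 * (cmod (c - f x) powr 5 + cmod (f x) powr 5))"
      by (simp add: abs_of_nonneg)
  qed simp
  then have "cmod c powr 5 = 0" by (rule const_integrable_lebesgue)
  then show ?thesis by simp
qed

text \<open>
Since \<open>1 + |x| \<le> 2 \<langle>x\<rangle>\<close>, the passage from \<open>\<langle>x\<rangle>\<close> to \<open>1 + |x|\<close> only changes the constant.
\<close>

lemma decaying_potential_of_decay: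
  assumes V_meas: "V \<in> borel_measurable lebesgue"
    and V_nonzero: "\<not> (AE x in lebesgue. V x = 0)"
    and decay: "decays_faster (rootV V) 3"
  obtains C \<epsilon> where "decaying_potential V C \<epsilon>"
proof -
  obtain C \<epsilon> where C: "C > 0" and eps: "\<epsilon> > 0"
    and le: "\<And>x. \<bar>rootV V x\<bar> \<le> C * japanese x powr (- 3 - \<epsilon>)"
    using decay unfolding decays_faster_def by blast
  define C' where "C' = C * (1/2) powr (- 3 - \<epsilon>)"
  have "rootV V x \<le> C' * (1 + norm x) powr (- 3 - \<epsilon>)" for x
  proof -
    have "(1 / 2) * (1 + norm x) \<le> japanese x"
    proof -
      have "2 * norm x \<le> 3 * (norm x)\<^sup>2 + 3"
        using sum_squares_bound[of 1 "norm x", simplified] zero_le_power2[of "norm x"] by linarith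
      then have "((1 / 2) * (1 + norm x))\<^sup>2 \<le> 1 + (norm x)\<^sup>2"
        by (simp add: power_mult_distrib power2_sum power_divide)
      then have "(1 / 2) * (1 + norm x) \<le> sqrt (1 + (norm x)\<^sup>2)" by (rule real_le_rsqrt)
      then show ?thesis by (simp add: japanese_def powr_half_sqrt)
    qed
    then have "japanese x powr (- 3 - \<epsilon>) \<le> ((1 / 2) * (1 + norm x)) powr (- 3 - \<epsilon>)"
      using eps by (intro powr_mono2') (auto simp: add_pos_nonneg)
    also have "\<dots> = (1/2) powr (- 3 - \<epsilon>) * (1 + norm x) powr (- 3 - \<epsilon>)"
      by (rule powr_mult)
    finally have "C * japanese x powr (- 3 - \<epsilon>) \<le> C' * (1 + norm x) powr (- 3 - \<epsilon>)"
      using C unfolding C'_def mult.assoc by (intro mult_left_mono) auto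
    then show ?thesis using le[of x] by linarith
  qed
  then show ?thesis using that[of C' \<epsilon>] assms eps by (simp add: decaying_potential_def)
qed

section \<open>The range of the second projection and integrability\<close>

theorem lemma7p3:
  fixes V :: "real^4 \<Rightarrow> real" and \<phi> \<psi> :: "real^4 \<Rightarrow> complex" and c\<^sub>0 :: complex
  assumes V_meas: "V \<in> borel_measurable lebesgue"
    and V_nonzero: "\<not> (AE x in lebesgue. V x = 0)"
    and decay: "decays_faster (rootV V) 3"
    and phi: "\<phi> \<in> range_L2 (S1 V)"
    and c0: "c\<^sub>0 = 1 / of_real (norm_L1 V) *
               (LINT x|lebesgue. of_real (rootV V x) * opT V \<phi> x)"
    and psi: "\<psi> = (\<lambda>x. c\<^sub>0 - G1 (\<lambda>y. of_real (rootV V y) * \<phi> y) x)"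
  shows "eq_ae \<phi> (\<lambda>x. of_real (sgnV V x) * of_real (rootV V x) * \<psi> x) \<and>
         (\<phi> \<in> range_L2 (S2 V) \<longleftrightarrow> (\<forall>p::ennreal. 4 < p \<and> p \<le> \<infinity> \<longrightarrow> \<psi> \<in> Lspace p))"
proof -
  obtain C \<epsilon> where "decaying_potential V C \<epsilon>"
    using decaying_potential_of_decay[OF V_meas V_nonzero decay] by blast
  then interpret decaying_potential V C \<epsilon> .
  have phi1: "\<phi> \<in> orth_compl S1_tests" using phi by (simp add: range_S1)
  then have phi_v: "\<phi> \<in> orth_compl {vc}" and phiL: "\<phi> \<in> L2"
    and T_eq: "eq_ae (T \<phi>) (\<lambda>x. coef (T \<phi>) * vc x)"
    using orth_compl_L2 by (auto simp: orth_compl_S1_tests_iff)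
  have c0_coef: "c\<^sub>0 = coef (T \<phi>)"
    by (simp add: c0 coef_def L2_inner_def L2_sq_v mult.commute)
  have psi_x: "\<psi> x = c\<^sub>0 - G1v \<phi> x" for x by (simp add: psi)
  have phi_eq: "eq_ae \<phi> (\<lambda>x. of_real (sgnV V x) * of_real (rootV V x) * \<psi> x)"
    using T_eq unfolding eq_ae_def
  proof eventually_elim
    case (elim x)
    have "of_real (sgnV V x) * (of_real (sgnV V x) * \<phi> x) = \<phi> x" by (simp add: sgnV_def)
    moreover have "of_real (sgnV V x) * \<phi> x = vc x * \<psi> x"
      using elim by (simp add: opT_def psi_x c0_coef algebra_simps)
    ultimately show ?case by (simp add: mult.assoc)
  qed
  obtain B where B: "\<And>x. cmod (G1v \<phi> x) \<le> B" using G1v_bounded[OF phi_v] by blast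
  \<comment> \<open>The decay lemma wants a pointwise bound, so \<open>\<phi>\<close> is replaced by the representative \<open>U v \<psi>\<close>.\<close>
  define \<phi>' where "\<phi>' x = of_real (sgnV V x) * of_real (rootV V x) * \<psi> x" for x
  have G_meas: "G1v \<phi> \<in> borel_measurable lebesgue" by (rule G1v_measurable[OF L2_measurable[OF phiL]])
  have phi'_meas: "\<phi>' \<in> borel_measurable lebesgue"
    using G_meas unfolding \<phi>'_def[abs_def] psi by measurable
  have phi'L: "\<phi>' \<in> L2"
    by (rule L2_bound[OF phi'_meas L2_integrable[OF phiL]])
       (use phi_eq in \<open>auto simp: eq_ae_def \<phi>'_def elim: AE_mp\<close>)
  have phi'_v: "\<phi>' \<in> orth_compl {vc}"
    by (rule orth_compl_cong[OF _ phi_v phi'L]) (use phi_eq v_L2 in \<open>auto simp: \<phi>'_def[abs_def]\<close>)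
  have "cmod (\<phi>' y) \<le> (cmod c\<^sub>0 + B) * v y" for y
  proof -
    have "cmod (\<phi>' y) = v y * cmod (\<psi> y)"
      using v_nonneg[of y] by (simp add: \<phi>'_def norm_mult sgnV_def)
    also have "\<dots> \<le> v y * (cmod c\<^sub>0 + B)"
      using B[of y] norm_triangle_ineq4[of "c\<^sub>0" "G1v \<phi> y"] v_nonneg[of y]
      by (intro mult_left_mono) (auto simp: psi_x)
    finally show ?thesis by (simp add: mult.commute)
  qed
  from G1v_decay[OF phi'_v this]
  obtain D where D: "\<And>x. cmod (G1v \<phi>' x) \<le> D * (1 + norm x) powr (- 1)" by blast
  have "G1v \<phi>' = G1v \<phi>"
    by (rule G1v_cong[OF phi'L phiL eq_ae_sym]) (use phi_eq in \<open>simp add: \<phi>'_def[abs_def]\<close>)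
  then have D: "cmod (G1v \<phi> x) \<le> D * (1 + norm x) powr (- 1)" for x using D[of x] by simp
  have "\<phi> \<in> range_L2 (S2 V) \<longleftrightarrow> c\<^sub>0 = 0"
    using phi1 by (simp add: range_S2 orth_compl_S2_tests_iff c0_coef coef_eq_0_iff)
  also have "\<dots> \<longleftrightarrow> (\<forall>p::ennreal. 4 < p \<and> p \<le> \<infinity> \<longrightarrow> \<psi> \<in> Lspace p)"
  proof (intro iffI allI impI)
    fix p :: ennreal assume c: "c\<^sub>0 = 0" and p: "4 < p \<and> p \<le> \<infinity>"
    have "\<psi> = (\<lambda>x. - G1v \<phi> x)" using c by (simp add: psi)
    moreover have "(\<lambda>x. - G1v \<phi> x) \<in> Lspace p"
      by (rule Lspace_decay_1[of _ D]) (use G_meas D p in auto)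
    ultimately show "\<psi> \<in> Lspace p" by simp
  next
    assume Lp: "\<forall>p::ennreal. 4 < p \<and> p \<le> \<infinity> \<longrightarrow> \<psi> \<in> Lspace p"
    have "(4::ennreal) < 5" by simp
    then have "\<psi> \<in> Lspace 5" "G1v \<phi> \<in> Lspace 5"
      using Lp Lspace_decay_1[OF G_meas D] by auto
    then show "c\<^sub>0 = 0" using const_diff_Lspace_5[of "c\<^sub>0" "G1v \<phi>"] by (simp add: psi)
  qed
  finally show ?thesis using phi_eq by blast
qed

end
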